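(* Let $d=2m\ge10$ with $m$ odd, $g=(d-1)(d-2)/2$, and $k$ a field of characteristic $0$ or $p>2g+1$ with separable closure $\overline{k}$. Let $\mathcal{C}'$ be the family of smooth $\overline{k}$-plane curves (parameters $a_2,\dots,a_m\in\overline{k}$ for which the curve is non-singular) $$X^d+Y^d+Z^d+X^mZ^m+X^{d-2}Y^2+a_2X^{d-4}Y^4+a_3X^{d-6}Y^6+\dots+a_{m-1}X^2Y^{d-2}+a_mX^{m-2}Y^2Z^m=0.$$ Then $\operatorname{Aut}(\mathcal{C}')=\langle[X:-Y:\zeta_mZ]\rangle$; in particular it is cyclic of order $d$.
   Context: $\zeta_m$ is a primitive $m$-th root of unity and $[X:-Y:\zeta_mZ]$ denotes the projective transformation $(X:Y:Z)\mapsto(X:-Y:\zeta_mZ)$. Automorphisms of smooth plane curves of degree $\ge4$ are induced by elements of $\operatorname{PGL}_3(\overline{k})$. *)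

theory Defs
  imports
    "HOL-Analysis.Analysis"
    "HOL-Algebra.Coset"
    "HOL-Algebra.Elementary_Groups"
    "HOL-Algebra.Algebraic_Closure_Type"
begin

definition separable_poly :: "'a::field poly \<Rightarrow> bool" where
  "separable_poly p \<longleftrightarrow> coprime p (pderiv p)"

text \<open>
  The embedding \<open>\<iota>\<close> exhibits the field \<open>'K\<close> as a separable closure of the field \<open>'k\<close>:
  every element of \<open>'K\<close> has a separable minimal polynomial over \<open>'k\<close>, and \<open>'K\<close> is
  separably closed.
\<close>

definition is_separable_closure :: "('k::field \<Rightarrow> 'K::field) \<Rightarrow> bool" where
  "is_separable_closure \<iota> \<longleftrightarrow>
     \<iota> 1 = 1 \<and> (\<forall>x y. \<iota> (x + y) = \<iota> x + \<iota> y) \<and> (\<forall>x y. \<iota> (x * y) = \<iota> x * \<iota> y) \<and>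
     (\<forall>x :: 'K. \<exists>p :: 'k poly. Factorial_Ring.irreducible p \<and> separable_poly p \<and> poly (map_poly \<iota> p) x = 0) \<and>
     (\<forall>q :: 'K poly. separable_poly q \<and> Polynomial.degree q > 0 \<longrightarrow> (\<exists>x. poly q x = 0))"

text \<open>
  Polynomials in three variables are elements of \<open>K[X][Y][Z]\<close>: the outermost
  polynomial variable is \<open>Z\<close>, the innermost one is \<open>X\<close>.
\<close>

type_synonym 'a poly3 = "'a poly poly poly"

definition const3 :: "'a::field \<Rightarrow> 'a poly3" where "const3 c = [:[:[:c:]:]:]"
definition varX :: "'a::field poly3" where "varX = [:[:[:0, 1:]:]:]"
definition varY :: "'a::field poly3" where "varY = [:[:0, 1:]:]"
definition varZ :: "'a::field poly3" where "varZ = [:0, 1:]"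

definition eval3 :: "'a::field poly3 \<Rightarrow> 'a ^ 3 \<Rightarrow> 'a" where
  "eval3 F v = poly (poly (poly F [:[:v $ 3:]:]) [:v $ 2:]) (v $ 1)"

definition dX :: "'a::field poly3 \<Rightarrow> 'a poly3" where "dX = map_poly (map_poly pderiv)"
definition dY :: "'a::field poly3 \<Rightarrow> 'a poly3" where "dY = map_poly pderiv"
definition dZ :: "'a::field poly3 \<Rightarrow> 'a poly3" where "dZ = pderiv"

lemma eval3_simps:
  "eval3 (const3 c) v = c" "eval3 varX v = v $ 1" "eval3 varY v = v $ 2" "eval3 varZ v = v $ 3"
  "eval3 (F + G) v = eval3 F v + eval3 G v" "eval3 (F * G) v = eval3 F v * eval3 G v"
  "eval3 (F ^ n) v = eval3 F v ^ n"
  by (simp_all add: eval3_def const3_def varX_def varY_def varZ_def)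

definition poly3_ac :: "'a::field poly3 \<Rightarrow> 'a alg_closure poly3" where
  "poly3_ac = map_poly (map_poly (map_poly to_ac))"

text \<open>
  The geometric points of the plane curve \<open>F = 0\<close>, for a homogeneous \<open>F\<close>, given by all
  their homogeneous coordinate vectors. A separably closed field need not be algebraically
  closed, so points and smoothness are taken over the algebraic closure.
\<close>

definition curve_points :: "'a::field poly3 \<Rightarrow> ('a alg_closure ^ 3) set" where
  "curve_points F = {v. v \<noteq> 0 \<and> eval3 (poly3_ac F) v = 0}"

definition smooth_curve :: "'a::field poly3 \<Rightarrow> bool" where
  "smooth_curve F \<longleftrightarrow>
     (\<forall>v \<in> curve_points F. eval3 (dX (poly3_ac F)) v \<noteq> 0 \<or>
        eval3 (dY (poly3_ac F)) v \<noteq> 0 \<or> eval3 (dZ (poly3_ac F)) v \<noteq> 0)"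

definition GL3 :: "('a::field ^ 3 ^ 3) monoid" where
  "GL3 = \<lparr>carrier = {A. invertible A}, mult = (**), one = mat 1\<rparr>"

definition scalars3 :: "('a::field ^ 3 ^ 3) set" where
  "scalars3 = {mat c | c. c \<noteq> 0}"

definition PGL3 :: "('a::field ^ 3 ^ 3) set monoid" where
  "PGL3 = GL3 Mod scalars3"

definition proj_class :: "'a::field ^ 3 ^ 3 \<Rightarrow> ('a ^ 3 ^ 3) set" where
  "proj_class A = scalars3 #>\<^bsub>GL3\<^esub> A"

definition mat_ac :: "'a::field ^ 3 ^ 3 \<Rightarrow> 'a alg_closure ^ 3 ^ 3" where
  "mat_ac A = (\<chi> i j. to_ac (A $ i $ j))"

text \<open>
  For a smooth plane curve of degree at least \<open>4\<close> every automorphism is induced by a unique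
  projective transformation of the plane, so the automorphism group is the subgroup of
  \<open>PGL\<^sub>3\<close> of the transformations that map the curve onto itself.
\<close>

definition curve_Aut :: "'a::field poly3 \<Rightarrow> ('a ^ 3 ^ 3) set set" where
  "curve_Aut F = proj_class ` {A. invertible A \<and> (\<lambda>v. mat_ac A *v v) ` curve_points F = curve_points F}"

definition diag3 :: "'a::field \<Rightarrow> 'a \<Rightarrow> 'a \<Rightarrow> 'a ^ 3 ^ 3" where
  "diag3 a b c = vector [vector [a, 0, 0], vector [0, b, 0], vector [0, 0, c]]"

definition primitive_root_of_unity :: "nat \<Rightarrow> 'a::field \<Rightarrow> bool" where
  "primitive_root_of_unity m \<zeta> \<longleftrightarrow> m > 0 \<and> \<zeta> ^ m = 1 \<and> (\<forall>j. 0 < j \<and> j < m \<longrightarrow> \<zeta> ^ j \<noteq> 1)"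

definition family_curve :: "nat \<Rightarrow> (nat \<Rightarrow> 'a::field) \<Rightarrow> 'a poly3" where
  "family_curve m a = (let d = 2 * m in
     varX ^ d + varY ^ d + varZ ^ d + varX ^ m * varZ ^ m + varX ^ (d - 2) * varY ^ 2
     + (\<Sum>i = 2..m - 1. const3 (a i) * varX ^ (d - 2 * i) * varY ^ (2 * i))
     + const3 (a m) * varX ^ (m - 2) * varY ^ 2 * varZ ^ m)"

lemma group_GL3: "group (GL3 :: ('a::field ^ 3 ^ 3) monoid)"
proof (rule groupI)
  fix x :: "'a ^ 3 ^ 3" assume "x \<in> carrier GL3"
  then obtain y where y: "x ** y = mat 1" "y ** x = mat 1" by (auto simp: GL3_def invertible_def)
  then have "invertible y" unfolding invertible_def by blast
  with y show "\<exists>y\<in>carrier GL3. y \<otimes>\<^bsub>GL3\<^esub> x = \<one>\<^bsub>GL3\<^esub>" by (auto simp: GL3_def)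
qed (auto simp: GL3_def invertible_mult matrix_mul_assoc invertible_def[of "mat 1"] intro: exI[of _ "mat 1"])

lemma scalar_mat_mult: "mat c ** A = (\<chi> i j. c * A $ i $ j)" "A ** mat c = (\<chi> i j. c * A $ i $ j)"
  for c :: "'a::field" and A :: "'a ^ 3 ^ 3"
  by (simp_all add: matrix_matrix_mult_def mat_def vec_eq_iff if_distrib if_distribR
      sum.delta sum.delta' mult.commute cong: if_cong)

lemma normal_scalars3: "scalars3 \<lhd> (GL3 :: ('a::field ^ 3 ^ 3) monoid)"
proof -
  interpret group "GL3 :: ('a ^ 3 ^ 3) monoid" by (rule group_GL3)
  have mm: "mat c ** mat d = (mat (c * d) :: 'a ^ 3 ^ 3)" for c d
    by (subst scalar_mat_mult(1)) (simp add: mat_def vec_eq_iff)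
  have inv: "invertible (mat c :: 'a ^ 3 ^ 3)" if "c \<noteq> 0" for c
    unfolding invertible_def by (rule exI[of _ "mat (inverse c)"]) (simp add: mm that)
  have sub: "subgroup scalars3 (GL3 :: ('a ^ 3 ^ 3) monoid)"
  proof (rule subgroupI)
    show "scalars3 \<subseteq> carrier (GL3 :: ('a ^ 3 ^ 3) monoid)"
      by (auto simp: scalars3_def GL3_def inv)
    show "scalars3 \<noteq> ({} :: ('a ^ 3 ^ 3) set)" by (auto simp: scalars3_def intro: exI[of _ 1])
    fix x y :: "'a ^ 3 ^ 3" assume "x \<in> scalars3"
    then obtain c where c: "x = mat c" "c \<noteq> 0" by (auto simp: scalars3_def)
    have "inv\<^bsub>GL3\<^esub> x = mat (inverse c)"
      by (rule inv_equality) (use c in \<open>auto simp: GL3_def mm inv\<close>)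
    then show "inv\<^bsub>GL3\<^esub> x \<in> scalars3" using c by (auto simp: scalars3_def)
    assume "y \<in> scalars3"
    then show "x \<otimes>\<^bsub>GL3\<^esub> y \<in> scalars3" using c by (auto simp: scalars3_def GL3_def mm)
  qed
  show ?thesis
  proof (rule normalI[OF sub], intro ballI)
    fix x :: "'a ^ 3 ^ 3"
    show "scalars3 #>\<^bsub>GL3\<^esub> x = x <#\<^bsub>GL3\<^esub> scalars3"
      by (auto simp: r_coset_def l_coset_def GL3_def scalars3_def scalar_mat_mult)
  qed
qed

lemma group_PGL3: "group (PGL3 :: ('a::field ^ 3 ^ 3) set monoid)"
  unfolding PGL3_def by (rule normal.factorgroup_is_group[OF normal_scalars3])

end

theory Submission
  imports Defs
begin

text \<open>
  Write the equation as \<open>F = Z\<^bsup>2m\<^esup> + B(X,Y) Z\<^bsup>m\<^esup> + G(X,Y)\<close>. For general \<open>(x,y)\<close> the polynomial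
  \<open>F(x,y,Z)\<close> has \<open>2m\<close> distinct roots, so a matrix \<open>A\<close> that preserves the set of points satisfies
  \<open>F(Av) = c F(v)\<close> with the constant \<open>c = F(A e\<^sub>3)\<close>.

  Let \<open>q = A e\<^sub>3\<close> and let \<open>\<lambda>\<close> be the third coordinate of \<open>A\<^bsup>-1\<^esup>v\<close>. Differentiating
  \<open>F(v + sq) = c F(A\<^bsup>-1\<^esup>v + s e\<^sub>3)\<close> at \<open>s = 0\<close> shows that \<open>\<lambda>\<^bsup>m-1\<^esup>\<close> divides the polar of \<open>F\<close> at \<open>q\<close>. In the
  variable \<open>Z\<close> this polar has only the exponents \<open>2m-1, m, m-1, 0\<close>, so it has no nonzero root of
  multiplicity \<open>m-1 \<ge> 4\<close>; this forces \<open>q\<close> to be proportional to \<open>e\<^sub>3\<close> and \<open>\<lambda>\<close> to \<open>Z\<close>, except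
  when \<open>\<lambda>\<close> does not involve \<open>Z\<close>, which a comparison of coefficients of \<open>G\<close> rules out. Then \<open>A\<close>
  acts on \<open>X, Y\<close> and on \<open>Z\<close> separately, and comparing coefficients of \<open>B\<close> and \<open>G\<close> shows that it
  is diagonal with entries \<open>p, \<plusminus>p, k\<close> where \<open>p\<^bsup>m\<^esup> = k\<^bsup>m\<^esup>\<close>.
\<close>

no_notation fps_nth (infixl \<open>$\<close> 75)

subsection \<open>Univariate polynomials\<close>

text \<open>Euclid's argument: over a finite field the product of all \<open>X - x\<close>, plus 1,
  would be a nonconstant polynomial that takes only the value 1.\<close>

lemma infinite_alg_closed_UNIV: "infinite (UNIV :: 'a::alg_closed_field set)"
proof
  assume fin: "finite (UNIV :: 'a set)"
  define p :: "'a poly" where "p = (\<Prod>x\<in>UNIV. [:- x, 1:]) + 1"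
  have deg: "Polynomial.degree (\<Prod>x\<in>(UNIV::'a set). [:- x, 1:]) = card (UNIV :: 'a set)"
    by (simp add: degree_prod_eq_sum_degree)
  have "card (UNIV :: 'a set) > 0"
    using fin by (simp add: card_gt_0_iff)
  then have "Polynomial.degree p > 0"
    unfolding p_def using deg by (subst degree_add_eq_left) auto
  then obtain x where "poly p x = 0"
    using alg_closed_imp_poly_has_root by blast
  moreover have "poly p x = 1"
    unfolding p_def using fin by (simp add: poly_prod)
  ultimately show False by simp
qed

text \<open>Turns identities that hold for all field elements into identities of polynomials. The
  coefficient comparisons below start from it.\<close>

lemma poly_eqI_alg_closed:
  fixes p q :: "'a::alg_closed_field poly"
  assumes "\<And>x. poly p x = poly q x"
  shows "p = q"
proof (rule ccontr)
  assume "p \<noteq> q"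
  then have "finite {x. poly (p - q) x = 0}"
    using poly_roots_finite[of "p - q"] by simp
  with assms infinite_alg_closed_UNIV[where 'a = 'a] show False by simp
qed

text \<open>A linear factor that occurs twice would give a common root of \<open>p\<close> and its
  derivative, so the multiset of roots is a set.\<close>

lemma card_roots_rsquarefree:
  fixes p :: "'a::alg_closed_field poly"
  assumes p0: "p \<noteq> 0" and sqf: "\<And>x. poly p x = 0 \<Longrightarrow> poly (pderiv p) x \<noteq> 0"
  shows "card {x. poly p x = 0} = Polynomial.degree p"
proof -
  obtain M where M: "size M = Polynomial.degree p"
      "p = Polynomial.smult (Polynomial.lead_coeff p) (\<Prod>x\<in>#M. [:- x, 1:])"
    using alg_closed_imp_factorization[OF p0] by blast
  have count1: "count M x \<le> 1" for x
  proof (rule ccontr)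
    assume "\<not> count M x \<le> 1"
    then have c2: "count M x \<ge> 2" by simp
    have "M = add_mset x (add_mset x (M - {#x, x#}))"
      by (rule multiset_eqI) (use c2 in auto)
    then obtain N where N: "M = add_mset x (add_mset x N)" by blast
    define r where "r = Polynomial.smult (Polynomial.lead_coeff p) (\<Prod>x\<in>#N. [:- x, 1:])"
    have pr: "p = [:- x, 1:] * ([:- x, 1:] * r)"
      using M(2) unfolding N r_def by (simp add: mult_smult_right del: mult_pCons_left)
    have "poly p x = 0" by (subst pr) simp
    moreover have "poly (pderiv p) x = 0"
      by (subst pr) (simp add: pderiv_mult del: mult_pCons_left)
    ultimately show False using sqf by blast
  qed
  have "M = mset_set (set_mset M)"
  proof (rule multiset_eqI)
    fix x show "count M x = count (mset_set (set_mset M)) x"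
      using count1[of x] by (cases "x \<in># M") (auto simp: count_mset_set' le_Suc_eq count_eq_zero_iff)
  qed
  then have "size M = card (set_mset M)" by (metis size_mset_set)
  moreover have "{x. poly p x = 0} = set_mset M"
  proof -
    have "poly p x = Polynomial.lead_coeff p * (\<Prod>y\<in>#M. x - y)" for x
      by (subst M(2)) (simp add: poly_prod_mset multiset.map_comp o_def)
    then show ?thesis using p0 by (auto simp: prod_mset_zero_iff)
  qed
  ultimately show ?thesis using M(1) by simp
qed

lemma linear_power_dvd_pderiv:
  fixes p :: "'a::field poly"
  assumes "[:- r, 1:] ^ Suc n dvd p"
  shows "[:- r, 1:] ^ n dvd pderiv p"
proof -
  obtain k where "p = [:- r, 1:] ^ Suc n * k" using assms by blast
  then have "pderiv p = [:- r, 1:] ^ n * (Polynomial.smult (of_nat (Suc n)) k + [:- r, 1:] * pderiv k)"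
    by (simp add: pderiv_mult pderiv_power_Suc pderiv_pCons algebra_simps del: power_Suc mult_pCons_left mult_pCons_right)
       (simp add: algebra_simps)
  then show ?thesis by simp
qed

text \<open>The order of vanishing at \<open>r\<close> is additive, and \<open>p\<close> contributes
  0 to it.\<close>

lemma linear_power_dvd_mult_cancel:
  fixes p q :: "'a::field poly"
  assumes "[:- r, 1:] ^ n dvd p * q" and "poly p r \<noteq> 0"
  shows "[:- r, 1:] ^ n dvd q"
proof (cases "q = 0")
  case False
  have "p \<noteq> 0" using assms(2) by auto
  moreover have "Polynomial.order r p = 0" using assms(2) by (rule order_0I)
  ultimately show ?thesis
    using assms(1) False by (simp add: order_divides order_mult)
qed simp

text \<open>
  By Descartes' argument, a nonzero polynomial with four terms has no nonzero root of
  multiplicity four, provided the exponents stay distinct in the field.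
\<close>
lemma four_terms_quadruple_root:
  fixes c1 c2 c3 c4 r :: "'a::field"
  assumes m: "m \<ge> 3" and nz: "\<And>n. 0 < n \<Longrightarrow> n \<le> 2 * m \<Longrightarrow> (of_nat n :: 'a) \<noteq> 0"
    and r: "r \<noteq> 0"
    and dvd: "[:- r, 1:] ^ 4 dvd Polynomial.monom c1 (2 * m - 1) + Polynomial.monom c2 m + Polynomial.monom c3 (m - 1) + [:c4:]"
  shows "c1 = 0 \<and> c2 = 0 \<and> c3 = 0 \<and> c4 = 0"
proof -
  define p where "p = Polynomial.monom c1 (2 * m - 1) + Polynomial.monom c2 m + Polynomial.monom c3 (m - 1) + [:c4:]"
  \<comment> \<open>\<open>u\<close> is the derivative of \<open>p\<close> divided by
    \<open>X^(m-2)\<close>, with exponents \<open>m\<close>, 1, 0. The second derivative of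
    \<open>u\<close>, then its first derivative, \<open>u\<close> itself and \<open>p\<close>, all
    evaluated at \<open>r\<close>, give \<open>c1 = 0\<close> to \<open>c4 = 0\<close> in
    turn.\<close>
  define u where "u = Polynomial.monom (of_nat (2 * m - 1) * c1) m + Polynomial.monom (of_nat m * c2) 1 + [:of_nat (m - 1) * c3:]"
  have "[:- r, 1:] ^ 3 dvd pderiv p"
    using linear_power_dvd_pderiv[of r 3 p] dvd by (simp add: p_def numeral_eq_Suc)
  also have "pderiv p = Polynomial.monom 1 (m - 2) * u"
    using m by (simp add: p_def u_def pderiv_add pderiv_monom mult_monom distrib_left pderiv_pCons
        flip: monom_0) (simp add: numeral_eq_Suc Suc_diff_Suc)
  finally have u3: "[:- r, 1:] ^ 3 dvd u"
    by (rule linear_power_dvd_mult_cancel) (use r in \<open>simp add: poly_monom\<close>)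
  have u2: "[:- r, 1:] ^ 2 dvd pderiv u"
    using linear_power_dvd_pderiv[of r 2 u] u3 by (simp add: numeral_eq_Suc)
  have u1: "[:- r, 1:] dvd pderiv (pderiv u)"
    using linear_power_dvd_pderiv[of r 1 "pderiv u"] u2 by (simp add: numeral_eq_Suc)
  have "poly (pderiv (pderiv u)) r = 0" using u1 by (simp add: poly_eq_0_iff_dvd)
  then have "of_nat (m - 1) * (of_nat m * (of_nat (2 * m - 1) * c1)) * r ^ (m - 2) = 0"
    using m by (simp add: u_def pderiv_add pderiv_monom pderiv_pCons poly_monom numeral_eq_Suc)
  then have c1: "c1 = 0"
    using nz[of "m - 1"] nz[of m] nz[of "2 * m - 1"] m r by simp
  have "[:- r, 1:] dvd pderiv u" using u2 by (metis dvd_power_le dvd_refl dvd_trans dvd_power zero_less_numeral)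
  then have "poly (pderiv u) r = 0" by (simp add: poly_eq_0_iff_dvd)
  then have c2: "c2 = 0"
    using c1 nz[of m] m by (simp add: u_def pderiv_add pderiv_monom pderiv_pCons poly_monom)
  have "[:- r, 1:] dvd u" using u3 by (metis dvd_trans dvd_power zero_less_numeral)
  then have "poly u r = 0" by (simp add: poly_eq_0_iff_dvd)
  then have c3: "c3 = 0"
    using c1 c2 nz[of "m - 1"] m by (simp add: u_def)
  have "[:- r, 1:] dvd p" using dvd unfolding p_def by (metis dvd_trans dvd_power zero_less_numeral)
  then have "poly p r = 0" by (simp add: poly_eq_0_iff_dvd)
  then show ?thesis using c1 c2 c3 by (simp add: p_def)
qed

text \<open>A bound on the degree together with a coefficient that may be 0. Unlike the exact
  degree, this passes through sums and products even when leading terms cancel.\<close>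

definition coeff_at_top :: "'a::comm_ring_1 poly \<Rightarrow> nat \<Rightarrow> 'a \<Rightarrow> bool" where
  "coeff_at_top p n c \<longleftrightarrow> Polynomial.degree p \<le> n \<and> poly.coeff p n = c"

lemma coeff_at_top_const: "coeff_at_top [:c:] 0 c"
  by (simp add: coeff_at_top_def)

lemma coeff_at_top_linear: "coeff_at_top [:u, c:] 1 c"
  by (simp add: coeff_at_top_def)

lemma coeff_at_top_add:
  "coeff_at_top p n c \<Longrightarrow> coeff_at_top q n d \<Longrightarrow> coeff_at_top (p + q) n (c + d)"
  by (simp add: coeff_at_top_def degree_add_le)

lemma coeff_at_top_mult:
  assumes "coeff_at_top p i c" "coeff_at_top q j d"
  shows "coeff_at_top (p * q) (i + j) (c * d)"
proof -
  have "Polynomial.degree (p * q) \<le> i + j"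
    using degree_mult_le[of p q] assms by (simp add: coeff_at_top_def)
  moreover have "poly.coeff (p * q) (i + j) = (\<Sum>k\<le>i + j. poly.coeff p k * poly.coeff q (i + j - k))"
    by (simp add: coeff_mult)
  moreover have "\<dots> = (\<Sum>k\<in>{i}. poly.coeff p k * poly.coeff q (i + j - k))"
  proof (rule sum.mono_neutral_right)
    show "\<forall>k\<in>{..i + j} - {i}. poly.coeff p k * poly.coeff q (i + j - k) = 0"
    proof
      fix k assume "k \<in> {..i + j} - {i}"
      then consider "k > i" | "i + j - k > j" by force
      then show "poly.coeff p k * poly.coeff q (i + j - k) = 0"
        using assms by cases (simp_all add: coeff_at_top_def coeff_eq_0)
    qed
  qed auto
  ultimately show ?thesis using assms by (simp add: coeff_at_top_def)
qed

lemma coeff_at_top_power: "coeff_at_top p i c \<Longrightarrow> coeff_at_top (p ^ n) (n * i) (c ^ n)"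
proof (induction n)
  case 0
  show ?case by (simp add: coeff_at_top_def)
next
  case (Suc n)
  then show ?case using coeff_at_top_mult[of p i c "p ^ n" "n * i" "c ^ n"] by simp
qed

lemma coeff_at_top_sum:
  assumes "\<And>i. i \<in> I \<Longrightarrow> coeff_at_top (f i) n (c i)"
  shows "coeff_at_top (\<Sum>i\<in>I. f i) n (\<Sum>i\<in>I. c i)"
  using assms
  by (induction I rule: infinite_finite_induct) (auto simp: coeff_at_top_add, simp_all add: coeff_at_top_def)

subsection \<open>The forms B, G and F\<close>

text \<open>The forms are defined over any commutative ring, so that one formula serves for field
  elements and for polynomials; in the latter case the parameters enter as constants
  \<open>[:b:]\<close> and \<open>[:a i:]\<close>.\<close>

definition formB :: "nat \<Rightarrow> 'a::comm_ring_1 \<Rightarrow> 'a \<Rightarrow> 'a \<Rightarrow> 'a" where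
  "formB m b x y = x ^ m + b * x ^ (m - 2) * y ^ 2"

definition formG :: "nat \<Rightarrow> (nat \<Rightarrow> 'a::comm_ring_1) \<Rightarrow> 'a \<Rightarrow> 'a \<Rightarrow> 'a" where
  "formG m a x y = x ^ (2 * m) + y ^ (2 * m) + x ^ (2 * m - 2) * y ^ 2
     + (\<Sum>i = 2..m - 1. a i * x ^ (2 * m - 2 * i) * y ^ (2 * i))"

definition formF :: "nat \<Rightarrow> (nat \<Rightarrow> 'a::comm_ring_1) \<Rightarrow> 'a \<Rightarrow> 'a \<Rightarrow> 'a \<Rightarrow> 'a" where
  "formF m a x y z = z ^ (2 * m) + formB m (a m) x y * z ^ m + formG m a x y"

text \<open>This and the next three definitions are the formal partial derivatives of
  \<open>formB\<close> and \<open>formG\<close>, written out so that the chain rule can be stated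
  for polynomial arguments.\<close>

definition formB_x :: "nat \<Rightarrow> 'a::comm_ring_1 \<Rightarrow> 'a \<Rightarrow> 'a \<Rightarrow> 'a" where
  "formB_x m b x y = of_nat m * x ^ (m - 1) + of_nat (m - 2) * b * x ^ (m - 3) * y ^ 2"

definition formB_y :: "nat \<Rightarrow> 'a::comm_ring_1 \<Rightarrow> 'a \<Rightarrow> 'a \<Rightarrow> 'a" where
  "formB_y m b x y = 2 * b * x ^ (m - 2) * y"

definition formG_x :: "nat \<Rightarrow> (nat \<Rightarrow> 'a::comm_ring_1) \<Rightarrow> 'a \<Rightarrow> 'a \<Rightarrow> 'a" where
  "formG_x m a x y = of_nat (2 * m) * x ^ (2 * m - 1) + of_nat (2 * m - 2) * x ^ (2 * m - 3) * y ^ 2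
     + (\<Sum>i = 2..m - 1. of_nat (2 * m - 2 * i) * a i * x ^ (2 * m - 2 * i - 1) * y ^ (2 * i))"

definition formG_y :: "nat \<Rightarrow> (nat \<Rightarrow> 'a::comm_ring_1) \<Rightarrow> 'a \<Rightarrow> 'a \<Rightarrow> 'a" where
  "formG_y m a x y = of_nat (2 * m) * y ^ (2 * m - 1) + 2 * x ^ (2 * m - 2) * y
     + (\<Sum>i = 2..m - 1. of_nat (2 * i) * a i * x ^ (2 * m - 2 * i) * y ^ (2 * i - 1))"

lemma poly_of_nat: "poly (of_nat n) x = of_nat n"
  by (simp add: of_nat_poly)

section \<open>Evaluation, chain rule and special coefficients of the forms\<close>

lemma poly_forms:
  fixes P Q R :: "'a::field poly"
  shows "poly (formB m [:b:] P Q) s = formB m b (poly P s) (poly Q s)"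
    "poly (formG m (\<lambda>i. [:a i:]) P Q) s = formG m a (poly P s) (poly Q s)"
    "poly (formF m (\<lambda>i. [:a i:]) P Q R) s = formF m a (poly P s) (poly Q s) (poly R s)"
    "poly (formB_x m [:b:] P Q) s = formB_x m b (poly P s) (poly Q s)"
    "poly (formB_y m [:b:] P Q) s = formB_y m b (poly P s) (poly Q s)"
    "poly (formG_x m (\<lambda>i. [:a i:]) P Q) s = formG_x m a (poly P s) (poly Q s)"
    "poly (formG_y m (\<lambda>i. [:a i:]) P Q) s = formG_y m a (poly P s) (poly Q s)"
  by (simp_all add: formB_def formG_def formF_def formB_x_def formB_y_def formG_x_def formG_y_def
      poly_sum poly_of_nat algebra_simps)

lemma pderiv_power': "pderiv (p ^ n) = of_nat n * p ^ (n - 1) * pderiv p"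
  for p :: "'a::field poly"
  by (simp add: pderiv_power of_nat_poly)

lemma pderiv_sum': "pderiv (\<Sum>i\<in>I. f i) = (\<Sum>i\<in>I. pderiv (f i))"
  for f :: "nat \<Rightarrow> 'a::field poly"
  by (induction I rule: infinite_finite_induct) (simp_all add: pderiv_add)

lemma pderiv_formB:
  fixes P Q :: "'a::field poly"
  assumes "m \<ge> 3"
  shows "pderiv (formB m [:b:] P Q) = formB_x m [:b:] P Q * pderiv P + formB_y m [:b:] P Q * pderiv Q"
proof -
  have "m - 2 - 1 = m - 3" by simp
  then show ?thesis
    by (simp add: formB_def formB_x_def formB_y_def pderiv_add pderiv_mult pderiv_power' pderiv_pCons
        del: mult_pCons_left mult_pCons_right) (simp add: algebra_simps del: mult_pCons_left mult_pCons_right)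
qed

lemma pderiv_formG:
  fixes P Q :: "'a::field poly"
  assumes "m \<ge> 3"
  shows "pderiv (formG m (\<lambda>i. [:a i:]) P Q)
    = formG_x m (\<lambda>i. [:a i:]) P Q * pderiv P + formG_y m (\<lambda>i. [:a i:]) P Q * pderiv Q"
proof -
  have [simp]: "2 * m - 2 - Suc 0 = 2 * m - 3" by simp
  have "pderiv ([:c:] * P ^ i * Q ^ j)
      = of_nat i * [:c:] * P ^ (i - 1) * Q ^ j * pderiv P + of_nat j * [:c:] * P ^ i * Q ^ (j - 1) * pderiv Q"
    for c i j
    by (simp add: pderiv_mult pderiv_power' pderiv_pCons algebra_simps del: mult_pCons_left mult_pCons_right)
  then have "pderiv (\<Sum>i = 2..m - 1. [:a i:] * P ^ (2 * m - 2 * i) * Q ^ (2 * i))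
    = (\<Sum>i = 2..m - 1. of_nat (2 * m - 2 * i) * [:a i:] * P ^ (2 * m - 2 * i - 1) * Q ^ (2 * i)) * pderiv P
    + (\<Sum>i = 2..m - 1. of_nat (2 * i) * [:a i:] * P ^ (2 * m - 2 * i) * Q ^ (2 * i - 1)) * pderiv Q"
    by (simp only: pderiv_sum' sum_distrib_right sum.distrib)
  moreover have "pderiv (P ^ (2 * m) + Q ^ (2 * m) + P ^ (2 * m - 2) * Q ^ 2)
    = (of_nat (2 * m) * P ^ (2 * m - 1) + of_nat (2 * m - 2) * P ^ (2 * m - 3) * Q ^ 2) * pderiv P
    + (of_nat (2 * m) * Q ^ (2 * m - 1) + 2 * P ^ (2 * m - 2) * Q) * pderiv Q"
    by (simp add: pderiv_add pderiv_mult pderiv_power' del: of_nat_mult of_nat_diff) (simp add: algebra_simps del: of_nat_mult)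
  ultimately show ?thesis
    unfolding formG_def formG_x_def formG_y_def pderiv_add[of "_ + _ + _"] by (simp only: distrib_right add_ac)
qed

lemma pderiv_formF:
  fixes P Q R :: "'a::field poly"
  assumes "m \<ge> 3"
  shows "pderiv (formF m (\<lambda>i. [:a i:]) P Q R)
    = (of_nat (2 * m) * R ^ (2 * m - 1) + of_nat m * formB m [:a m:] P Q * R ^ (m - 1)) * pderiv R
      + (formB_x m [:a m:] P Q * pderiv P + formB_y m [:a m:] P Q * pderiv Q) * R ^ m
      + formG_x m (\<lambda>i. [:a i:]) P Q * pderiv P + formG_y m (\<lambda>i. [:a i:]) P Q * pderiv Q"
  by (simp add: formF_def pderiv_add pderiv_mult pderiv_power' pderiv_formB[OF assms] pderiv_formG[OF assms]
      del: of_nat_mult) (simp add: algebra_simps)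

text \<open>The bound on \<open>m\<close> keeps the exponent \<open>m - 3\<close> positive, so that
  the powers of 0 vanish.\<close>

lemma formB_axes:
  assumes "m \<ge> 4"
  shows "formB m b 0 y = 0" "formB m b x 0 = x ^ m"
    "formB_x m b 0 y = 0" "formB_y m b 0 y = 0" "formB_x m b x 0 = of_nat m * x ^ (m - 1)" "formB_y m b x 0 = 0"
  using assms by (auto simp: formB_def formB_x_def formB_y_def power_0_left)

lemma formG_axes:
  assumes "m \<ge> 3"
  shows "formG m a 0 y = y ^ (2 * m)" "formG m a x 0 = x ^ (2 * m)"
    "formG_x m a 0 y = 0" "formG_y m a 0 y = of_nat (2 * m) * y ^ (2 * m - 1)"
    "formG_x m a x 0 = of_nat (2 * m) * x ^ (2 * m - 1)" "formG_y m a x 0 = 0"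
proof -
  have "(\<Sum>i = 2..m - 1. a i * 0 ^ (2 * m - 2 * i) * y ^ (2 * i)) = 0"
    "(\<Sum>i = 2..m - 1. of_nat (2 * m - 2 * i) * a i * 0 ^ (2 * m - 2 * i - 1) * y ^ (2 * i)) = 0"
    "(\<Sum>i = 2..m - 1. of_nat (2 * i) * a i * 0 ^ (2 * m - 2 * i) * y ^ (2 * i - 1)) = 0"
    "(\<Sum>i = 2..m - 1. a i * x ^ (2 * m - 2 * i) * 0 ^ (2 * i)) = 0"
    "(\<Sum>i = 2..m - 1. of_nat (2 * m - 2 * i) * a i * x ^ (2 * m - 2 * i - 1) * 0 ^ (2 * i)) = 0"
    "(\<Sum>i = 2..m - 1. of_nat (2 * i) * a i * x ^ (2 * m - 2 * i) * 0 ^ (2 * i - 1)) = 0"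
    by (rule sum.neutral; auto simp: power_0_left)+
  then show "formG m a 0 y = y ^ (2 * m)" "formG m a x 0 = x ^ (2 * m)"
    "formG_x m a 0 y = 0" "formG_y m a 0 y = of_nat (2 * m) * y ^ (2 * m - 1)"
    "formG_x m a x 0 = of_nat (2 * m) * x ^ (2 * m - 1)" "formG_y m a x 0 = 0"
    using assms by (auto simp: formG_def formG_x_def formG_y_def power_0_left simp del: of_nat_mult of_nat_diff)
qed

lemma linear0_power: "[:0, c:] ^ n = Polynomial.monom (c ^ n) n" for c :: "'a::field"
  by (induction n) (simp_all add: mult_monom smult_monom flip: monom_Suc)

text \<open>In \<open>G\<close> the second variable occurs only to even powers, and its square only
  in \<open>X^(2m-2) Y^2\<close>, whose coefficient is 1 in the whole family. These two rigid
  coefficients later exclude unwanted symmetries.\<close>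

lemma coeff_formG_y:
  fixes x q :: "'a::field"
  assumes "m \<ge> 3"
  shows "poly.coeff (formG m (\<lambda>i. [:a i:]) [:x:] [:0, q:]) (2 * m - 1) = 0"
    "poly.coeff (formG m (\<lambda>i. [:a i:]) [:x:] [:0, q:]) 2 = x ^ (2 * m - 2) * q ^ 2"
proof -
  have *: "formG m (\<lambda>i. [:a i:]) [:x:] [:0, q:] = [:x ^ (2 * m):] + Polynomial.monom (q ^ (2 * m)) (2 * m)
     + Polynomial.monom (x ^ (2 * m - 2) * q ^ 2) 2
     + (\<Sum>i = 2..m - 1. Polynomial.monom (a i * x ^ (2 * m - 2 * i) * q ^ (2 * i)) (2 * i))"
    unfolding formG_def linear0_power by (simp add: poly_const_pow smult_monom mult_ac)
  have "2 * m - 1 \<noteq> 2 * i" for i using assms by presburger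
  then show "poly.coeff (formG m (\<lambda>i. [:a i:]) [:x:] [:0, q:]) (2 * m - 1) = 0"
    unfolding * using assms by (auto simp: coeff_sum coeff_pCons split: nat.splits intro!: sum.neutral)
  show "poly.coeff (formG m (\<lambda>i. [:a i:]) [:x:] [:0, q:]) 2 = x ^ (2 * m - 2) * q ^ 2"
    unfolding * using assms by (auto simp: coeff_sum coeff_pCons split: nat.splits intro!: sum.neutral)
qed

text \<open>The same monomial \<open>X^(2m-2) Y^2\<close>, now read off in the first
  variable.\<close>

lemma coeff_formG_x:
  fixes y q :: "'a::field"
  assumes "m \<ge> 3"
  shows "poly.coeff (formG m (\<lambda>i. [:a i:]) [:0, q:] [:y:]) (2 * m - 2) = q ^ (2 * m - 2) * y ^ 2"
proof -
  have *: "formG m (\<lambda>i. [:a i:]) [:0, q:] [:y:] = Polynomial.monom (q ^ (2 * m)) (2 * m) + [:y ^ (2 * m):]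
     + Polynomial.monom (q ^ (2 * m - 2) * y ^ 2) (2 * m - 2)
     + (\<Sum>i = 2..m - 1. Polynomial.monom (a i * q ^ (2 * m - 2 * i) * y ^ (2 * i)) (2 * m - 2 * i))"
    unfolding formG_def linear0_power by (simp add: poly_const_pow smult_monom mult_ac)
  show ?thesis
    unfolding * using assms by (auto simp: coeff_sum coeff_pCons split: nat.splits intro!: sum.neutral)
qed

lemma coeff_at_top_term:
  assumes "coeff_at_top P 1 p" "coeff_at_top Q 1 q" "i + j = n"
  shows "coeff_at_top ([:c:] * P ^ i * Q ^ j) n (c * p ^ i * q ^ j)"
  using coeff_at_top_mult[OF coeff_at_top_mult[OF coeff_at_top_const[of c]
    coeff_at_top_power[OF assms(1), of i]] coeff_at_top_power[OF assms(2), of j]] assms(3) by simp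

lemma coeff_at_top_formB:
  assumes "coeff_at_top P 1 p" "coeff_at_top Q 1 q" "m \<ge> 2"
  shows "coeff_at_top (formB m [:b:] P Q) m (formB m b p q)"
  unfolding formB_def using assms coeff_at_top_power[OF assms(1), of m]
  by (intro coeff_at_top_add coeff_at_top_term) auto

lemma coeff_at_top_formG:
  assumes "coeff_at_top P 1 p" "coeff_at_top Q 1 q" "m \<ge> 2"
  shows "coeff_at_top (formG m (\<lambda>i. [:a i:]) P Q) (2 * m) (formG m a p q)"
proof -
  have "coeff_at_top (P ^ (2 * m - 2) * Q ^ 2) (2 * m) (p ^ (2 * m - 2) * q ^ 2)"
    using coeff_at_top_term[OF assms(1,2), of "2 * m - 2" 2 "2 * m" 1] assms(3) by simp
  then show ?thesis
    unfolding formG_def using assms coeff_at_top_power[OF assms(1), of "2 * m"] coeff_at_top_power[OF assms(2), of "2 * m"]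
    by (intro coeff_at_top_add coeff_at_top_sum coeff_at_top_term) auto
qed

lemma coeff_at_top_formF:
  assumes "coeff_at_top P 1 p" "coeff_at_top Q 1 q" "coeff_at_top R 1 r" "m \<ge> 2"
  shows "coeff_at_top (formF m (\<lambda>i. [:a i:]) P Q R) (2 * m) (formF m a p q r)"
  unfolding formF_def
  using coeff_at_top_mult[OF coeff_at_top_formB[OF assms(1,2,4)] coeff_at_top_power[OF assms(3), of m]]
    coeff_at_top_power[OF assms(3), of "2 * m"]
  by (intro coeff_at_top_add coeff_at_top_formG assms) (simp_all add: mult_2)

subsection \<open>Linear symmetries of F\<close>

definition coord :: "'a::comm_ring_1 ^ 3 ^ 3 \<Rightarrow> 3 \<Rightarrow> 'a \<Rightarrow> 'a \<Rightarrow> 'a \<Rightarrow> 'a" where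
  "coord A i x y z = A $ i $ 1 * x + A $ i $ 2 * y + A $ i $ 3 * z"

lemma coord_inverse:
  fixes A N :: "'a::comm_ring_1 ^ 3 ^ 3"
  assumes "A ** N = mat 1"
  shows "coord A 1 (coord N 1 x y z) (coord N 2 x y z) (coord N 3 x y z) = x"
    "coord A 2 (coord N 1 x y z) (coord N 2 x y z) (coord N 3 x y z) = y"
    "coord A 3 (coord N 1 x y z) (coord N 2 x y z) (coord N 3 x y z) = z"
proof -
  define v :: "'a ^ 3" where "v = vector [x, y, z]"
  have v: "v $ 1 = x" "v $ 2 = y" "v $ 3 = z" by (simp_all add: v_def)
  have cv: "coord M i (u $ 1) (u $ 2) (u $ 3) = (M *v u) $ i" for M :: "'a ^ 3 ^ 3" and u i
    by (simp add: coord_def matrix_vector_mult_def sum_3)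
  have "A *v (N *v v) = v" using assms by (simp add: matrix_vector_mul_assoc)
  then show "coord A 1 (coord N 1 x y z) (coord N 2 x y z) (coord N 3 x y z) = x"
    "coord A 2 (coord N 1 x y z) (coord N 2 x y z) (coord N 3 x y z) = y"
    "coord A 3 (coord N 1 x y z) (coord N 2 x y z) (coord N 3 x y z) = z"
    unfolding v[symmetric] cv by simp_all
qed

section \<open>From invariance of the zero set to invariance of \<open>F\<close> up to a
  constant\<close>

locale family =
  fixes m :: nat and a :: "nat \<Rightarrow> 'a::alg_closed_field"
  assumes m5: "m \<ge> 5" and nz: "\<And>n. 0 < n \<Longrightarrow> n \<le> 2 * m \<Longrightarrow> (of_nat n :: 'a) \<noteq> 0"
begin

abbreviation "F \<equiv> formF m a"
abbreviation "B \<equiv> formB m (a m)"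
abbreviation "G \<equiv> formG m a"

text \<open>\<open>F\<close> is the quadratic \<open>w^2 + B w + G\<close> in
  \<open>w = z^m\<close>. A double root in \<open>z\<close> requires \<open>w = 0\<close>, excluded
  by \<open>G \<noteq> 0\<close>, or a double root in \<open>w\<close>, excluded by the
  discriminant.\<close>

lemma card_roots_formF:
  assumes G: "G x y \<noteq> 0" and D: "B x y ^ 2 - 4 * G x y \<noteq> 0"
  shows "card {z. F x y z = 0} = 2 * m"
proof -
  define p where "p = formF m (\<lambda>i. [:a i:]) [:x:] [:y:] [:0, 1:]"
  have top: "coeff_at_top p (2 * m) (F 0 0 1)"
    unfolding p_def by (rule coeff_at_top_formF) (use m5 in \<open>simp_all add: coeff_at_top_def coeff_pCons\<close>)
  have "F 0 0 1 = 1" using m5 by (simp add: formF_def formG_axes formB_axes power_0_left)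
  with top have deg: "Polynomial.degree p = 2 * m" "p \<noteq> 0"
    using le_degree[of p "2 * m"] by (auto simp: coeff_at_top_def)
  have p: "poly p z = F x y z" for z by (simp add: p_def poly_forms)
  have p': "poly (pderiv p) z = of_nat m * z ^ (m - 1) * (2 * z ^ m + B x y)" for z
  proof -
    have "2 * m - 1 = m - 1 + m" using m5 by simp
    then show ?thesis
      unfolding p_def using m5
      by (subst pderiv_formF) (simp_all add: poly_forms pderiv_pCons poly_of_nat distrib_left mult_ac flip: power_add)
  qed
  have "poly (pderiv p) z \<noteq> 0" if "poly p z = 0" for z
  proof
    assume "poly (pderiv p) z = 0"
    then consider "z = 0" | "B x y = - 2 * z ^ m"
      unfolding p' using nz[of m] m5 by (auto simp: add_eq_0_iff)
    then show False
    proof cases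
      case 1
      then show False using that G m5 by (simp add: p formF_def power_0_left)
    next
      case 2
      have "z ^ (2 * m) = (z ^ m) ^ 2" by (metis power_mult mult.commute)
      with 2 that have "G x y = (z ^ m) ^ 2"
        by (simp add: p formF_def power2_eq_square algebra_simps)
      with 2 D show False by (simp add: power2_eq_square)
    qed
  qed
  from card_roots_rsquarefree[OF deg(2) this] deg(1) show ?thesis by (simp add: p)
qed

text \<open>For generic \<open>(x, y)\<close> both sides are polynomials in \<open>z\<close> of
  degree at most \<open>2m\<close> that agree at the \<open>2m\<close> roots of \<open>F\<close> and
  in the coefficient of \<open>z^(2m)\<close>. A density argument in \<open>y\<close> then covers
  all points.\<close>

lemma formF_linear_change:
  assumes zeros: "\<And>x y z. F x y z = 0 \<Longrightarrow> F (coord A 1 x y z) (coord A 2 x y z) (coord A 3 x y z) = 0"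
  shows "F (coord A 1 x y z) (coord A 2 x y z) (coord A 3 x y z)
    = F (A $ 1 $ 3) (A $ 2 $ 3) (A $ 3 $ 3) * F x y z"
proof -
  define c where "c = F (A $ 1 $ 3) (A $ 2 $ 3) (A $ 3 $ 3)"
  have generic: "F (coord A 1 x y z) (coord A 2 x y z) (coord A 3 x y z) = c * F x y z"
    if "G x y \<noteq> 0" "B x y ^ 2 - 4 * G x y \<noteq> 0" for x y z
  proof -
    define p where "p = formF m (\<lambda>i. [:a i:]) [:x:] [:y:] [:0, 1:]"
    define h where "h = formF m (\<lambda>i. [:a i:]) [:A $ 1 $ 1 * x + A $ 1 $ 2 * y, A $ 1 $ 3:]
      [:A $ 2 $ 1 * x + A $ 2 $ 2 * y, A $ 2 $ 3:] [:A $ 3 $ 1 * x + A $ 3 $ 2 * y, A $ 3 $ 3:]"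
    have p: "poly p z = F x y z" for z by (simp add: p_def poly_forms)
    have h: "poly h z = F (coord A 1 x y z) (coord A 2 x y z) (coord A 3 x y z)" for z
      by (simp add: h_def poly_forms coord_def mult.commute)
    have ptop: "coeff_at_top p (2 * m) (F 0 0 1)"
      unfolding p_def by (rule coeff_at_top_formF) (use m5 in \<open>simp_all add: coeff_at_top_def coeff_pCons\<close>)
    have htop: "coeff_at_top h (2 * m) c"
      unfolding h_def c_def using m5 by (intro coeff_at_top_formF coeff_at_top_linear) auto
    have "F 0 0 1 = 1" using m5 by (simp add: formF_def formG_axes formB_axes power_0_left)
    have "h = Polynomial.smult c p"
    proof (rule poly_eqI_degree_lead_coeff)
      show "poly.coeff h (2 * m) = poly.coeff (Polynomial.smult c p) (2 * m)"
        "Polynomial.degree h \<le> 2 * m"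
        using ptop htop \<open>F 0 0 1 = 1\<close> by (simp_all add: coeff_at_top_def)
      show "Polynomial.degree (Polynomial.smult c p) \<le> 2 * m"
        using ptop degree_smult_le[of c p] by (simp add: coeff_at_top_def)
      show "2 * m \<le> card {z. F x y z = 0}" using card_roots_formF[OF that] by simp
      show "poly h z = poly (Polynomial.smult c p) z" if "z \<in> {z. F x y z = 0}" for z
        using that zeros by (simp add: p h)
    qed
    then have "poly h z = c * poly p z" by simp
    then show ?thesis by (simp add: p h)
  qed
  \<comment> \<open>Now \<open>x\<close> and \<open>z\<close> are fixed and \<open>y\<close> is the
    variable. \<open>H\<close> is the difference of both sides; it vanishes wherever
    \<open>G\<close> and the discriminant do not.\<close>
  define G1 where "G1 = formG m (\<lambda>i. [:a i:]) [:x:] [:0, 1:]"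
  define B1 where "B1 = formB m [:a m:] [:x:] [:0, 1:]"
  define H where "H = formF m (\<lambda>i. [:a i:]) [:A $ 1 $ 1 * x + A $ 1 $ 3 * z, A $ 1 $ 2:]
      [:A $ 2 $ 1 * x + A $ 2 $ 3 * z, A $ 2 $ 2:] [:A $ 3 $ 1 * x + A $ 3 $ 3 * z, A $ 3 $ 2:]
      - Polynomial.smult c (formF m (\<lambda>i. [:a i:]) [:x:] [:0, 1:] [:z:])"
  have G1: "poly G1 y = G x y" and B1: "poly B1 y = B x y"
    and H: "poly H y = F (coord A 1 x y z) (coord A 2 x y z) (coord A 3 x y z) - c * F x y z" for y
    by (simp_all add: G1_def B1_def H_def poly_forms coord_def algebra_simps)
  have G1top: "coeff_at_top G1 (2 * m) (G 0 1)" and B1top: "coeff_at_top B1 m (B 0 1)"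
    unfolding G1_def B1_def by (rule coeff_at_top_formG coeff_at_top_formB;
        use m5 in \<open>simp add: coeff_at_top_def coeff_pCons\<close>)+
  have "G1 \<noteq> 0"
    using G1top m5 by (auto simp: coeff_at_top_def formG_axes)
  moreover have "B1 ^ 2 - [:4:] * G1 \<noteq> 0"
  proof -
    \<comment> \<open>\<open>B 0 1 = 0\<close> and \<open>G 0 1 = 1\<close>, so
      \<open>y^(2m)\<close> comes only from \<open>- 4 G\<close>. The genericity condition is
      therefore nontrivial for every \<open>x\<close>.\<close>
    have "poly.coeff (B1 ^ 2 - [:4:] * G1) (2 * m) = - 4"
      using coeff_at_top_power[OF B1top, of 2] G1top m5
      by (simp add: coeff_at_top_def formG_axes formB_axes)
    moreover have "(- 4 :: 'a) \<noteq> 0" using nz[of 4] m5 by simp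
    ultimately show ?thesis by (metis coeff_0)
  qed
  moreover have "H * (G1 * (B1 ^ 2 - [:4:] * G1)) = 0"
  proof (rule poly_eqI_alg_closed)
    fix y
    show "poly (H * (G1 * (B1 ^ 2 - [:4:] * G1))) y = poly 0 y"
      using generic[of x y z] by (cases "G x y = 0"; cases "B x y ^ 2 - 4 * G x y = 0") (simp_all add: G1 B1 H)
  qed
  ultimately have "H = 0" by simp
  then show ?thesis using H[of y] by (simp add: c_def)
qed

end

section \<open>Symmetries up to a scalar: the third coordinate splits off and the matrix is
  diagonal\<close>

locale family_symmetry = family +
  fixes A N :: "'a ^ 3 ^ 3" and c :: 'a
  assumes AN: "A ** N = mat 1" and NA: "N ** A = mat 1" and c0: "c \<noteq> 0"
    and sym: "\<And>x y z. F (coord A 1 x y z) (coord A 2 x y z) (coord A 3 x y z) = c * F x y z"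
begin

text \<open>As \<open>N\<close> inverts \<open>A\<close>, the point \<open>N v\<close> shifted by
  \<open>s\<close> in its third coordinate is mapped by \<open>A\<close> to \<open>v + s q\<close>,
  where \<open>q\<close> is the third column of \<open>A\<close>.\<close>

lemma formF_line:
  "F (x + s * A $ 1 $ 3) (y + s * A $ 2 $ 3) (z + s * A $ 3 $ 3)
    = c * F (coord N 1 x y z) (coord N 2 x y z) (coord N 3 x y z + s)"
proof -
  have "coord A i x' y' (z' + s) = coord A i x' y' z' + s * A $ i $ 3" for i x' y' z'
    by (simp add: coord_def algebra_simps)
  then show ?thesis
    using sym[of "coord N 1 x y z" "coord N 2 x y z" "coord N 3 x y z + s"] coord_inverse[OF AN]
    by simp
qed

lemma formF_line_poly:
  "formF m (\<lambda>i. [:a i:]) [:x, A $ 1 $ 3:] [:y, A $ 2 $ 3:] [:z, A $ 3 $ 3:]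
    = Polynomial.smult c (formF m (\<lambda>i. [:a i:]) [:coord N 1 x y z:] [:coord N 2 x y z:] [:coord N 3 x y z, 1:])"
proof (rule poly_eqI_alg_closed)
  fix s
  show "poly (formF m (\<lambda>i. [:a i:]) [:x, A $ 1 $ 3:] [:y, A $ 2 $ 3:] [:z, A $ 3 $ 3:]) s
    = poly (Polynomial.smult c (formF m (\<lambda>i. [:a i:]) [:coord N 1 x y z:] [:coord N 2 x y z:] [:coord N 3 x y z, 1:])) s"
    using formF_line[of x s y z] by (simp add: poly_forms)
qed

text \<open>This is the derivative at \<open>s = 0\<close> of the identity along the line: the polar
  of \<open>F\<close> at \<open>q\<close> on the left, \<open>c\<close> times the
  \<open>Z\<close>-derivative of \<open>F\<close> at \<open>N v\<close> on the right. Positional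
  instantiations take the variables in the order \<open>z\<close>, \<open>x\<close>,
  \<open>y\<close>.\<close>

lemma polar:
  "of_nat (2 * m) * A $ 3 $ 3 * z ^ (2 * m - 1)
    + (formB_x m (a m) x y * A $ 1 $ 3 + formB_y m (a m) x y * A $ 2 $ 3) * z ^ m
    + of_nat m * A $ 3 $ 3 * B x y * z ^ (m - 1)
    + (formG_x m a x y * A $ 1 $ 3 + formG_y m a x y * A $ 2 $ 3)
    = c * of_nat m * coord N 3 x y z ^ (m - 1)
      * (2 * coord N 3 x y z ^ m + B (coord N 1 x y z) (coord N 2 x y z))"
proof -
  have e: "u ^ (m * 2 - Suc 0) = u ^ m * u ^ (m - Suc 0)" for u :: 'a
  proof -
    have "m * 2 - Suc 0 = m + (m - Suc 0)" using m5 by simp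
    then show ?thesis by (simp only: power_add)
  qed
  have "poly (pderiv (formF m (\<lambda>i. [:a i:]) [:x, A $ 1 $ 3:] [:y, A $ 2 $ 3:] [:z, A $ 3 $ 3:])) 0
    = poly (pderiv (Polynomial.smult c (formF m (\<lambda>i. [:a i:])
        [:coord N 1 x y z:] [:coord N 2 x y z:] [:coord N 3 x y z, 1:]))) 0"
    by (simp only: formF_line_poly)
  then show ?thesis
    using m5 by (simp add: pderiv_formF pderiv_smult pderiv_pCons poly_forms poly_of_nat)
      (simp add: distrib_left mult_ac add_ac e)
qed


text \<open>With \<open>z\<close> as polynomial variable, the right side shows a root of
  multiplicity at least \<open>m - 1\<close> when \<open>N $ 3 $ 3 \<noteq> 0\<close>; otherwise its
  first factor is constant and coefficients can be compared.\<close>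

lemma polar_poly:
  "Polynomial.monom (of_nat (2 * m) * A $ 3 $ 3) (2 * m - 1)
    + Polynomial.monom (formB_x m (a m) x y * A $ 1 $ 3 + formB_y m (a m) x y * A $ 2 $ 3) m
    + Polynomial.monom (of_nat m * A $ 3 $ 3 * B x y) (m - 1)
    + [:formG_x m a x y * A $ 1 $ 3 + formG_y m a x y * A $ 2 $ 3:]
    = [:coord N 3 x y 0, N $ 3 $ 3:] ^ (m - 1)
      * Polynomial.smult (c * of_nat m) (2 * [:coord N 3 x y 0, N $ 3 $ 3:] ^ m
        + formB m [:a m:] [:coord N 1 x y 0, N $ 1 $ 3:] [:coord N 2 x y 0, N $ 2 $ 3:])"
    (is "?l = ?r")
proof (rule poly_eqI_alg_closed)
  fix z
  have "coord N i x y z = coord N i x y 0 + z * N $ i $ 3" for i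
    by (simp add: coord_def)
  then show "poly ?l z = poly ?r z"
    using polar[of z x y] by (simp add: poly_monom poly_forms mult_ac del: of_nat_mult)
qed

lemma center_fixed:
  assumes ga: "N $ 3 $ 3 \<noteq> 0"
  shows "A $ 1 $ 3 = 0" "A $ 2 $ 3 = 0" "N $ 3 $ 1 = 0" "N $ 3 $ 2 = 0"
proof -
  \<comment> \<open>For each \<open>(x, y)\<close> the root \<open>r\<close> of the third coordinate
    of \<open>N v\<close> is a root of the polar of multiplicity at least 4. Either
    \<open>r = 0\<close>, or all four coefficients of the polar vanish.\<close>
  have dichotomy: "coord N 3 x y 0 = 0 \<or> A $ 3 $ 3 = 0 \<and>
      formG_x m a x y * A $ 1 $ 3 + formG_y m a x y * A $ 2 $ 3 = 0" for x y
  proof (rule disjCI)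
    assume *: "\<not> (A $ 3 $ 3 = 0 \<and> formG_x m a x y * A $ 1 $ 3 + formG_y m a x y * A $ 2 $ 3 = 0)"
    define r where "r = - coord N 3 x y 0 / N $ 3 $ 3"
    have lin: "[:coord N 3 x y 0, N $ 3 $ 3:] = [:N $ 3 $ 3:] * [:- r, 1:]"
      using ga by (simp add: r_def)
    have "[:- r, 1:] ^ 4 dvd [:- r, 1:] ^ (m - 1)" using m5 by (intro le_imp_power_dvd) simp
    also have "\<dots> dvd [:coord N 3 x y 0, N $ 3 $ 3:] ^ (m - 1)"
      unfolding lin power_mult_distrib by simp
    finally have "[:- r, 1:] ^ 4 dvd Polynomial.monom (of_nat (2 * m) * A $ 3 $ 3) (2 * m - 1)
      + Polynomial.monom (formB_x m (a m) x y * A $ 1 $ 3 + formB_y m (a m) x y * A $ 2 $ 3) m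
      + Polynomial.monom (of_nat m * A $ 3 $ 3 * B x y) (m - 1)
      + [:formG_x m a x y * A $ 1 $ 3 + formG_y m a x y * A $ 2 $ 3:]"
      unfolding polar_poly by (rule dvd_mult2)
    with * nz[of "2 * m"] m5 have "r = 0"
      using four_terms_quadruple_root[OF _ nz, of m r "of_nat (2 * m) * A $ 3 $ 3"] by fastforce
    then show "coord N 3 x y 0 = 0" using ga by (simp add: r_def)
  qed
  \<comment> \<open>In the first case of the dichotomy the polar relation at \<open>z = 0\<close>
    reads \<open>DG = 0\<close>, since the right side contains \<open>0 ^ (m - 1)\<close>.\<close>
  have DG: "formG_x m a x y * A $ 1 $ 3 + formG_y m a x y * A $ 2 $ 3 = 0" for x y
    using dichotomy[of x y] polar[of 0 x y] m5 by (auto simp: power_0_left)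
  have n: "(of_nat (2 * m) :: 'a) \<noteq> 0" using nz[of "2 * m"] m5 by simp
  show q1: "A $ 1 $ 3 = 0" using DG[of 1 0] n m5 by (simp add: formG_axes del: of_nat_mult)
  show q2: "A $ 2 $ 3 = 0" using DG[of 0 1] n m5 by (simp add: formG_axes del: of_nat_mult)
  have "N $ 3 $ 1 * A $ 1 $ 3 + N $ 3 $ 2 * A $ 2 $ 3 + N $ 3 $ 3 * A $ 3 $ 3 = 1"
    using arg_cong[OF NA, of "\<lambda>M. M $ 3 $ 3"] by (simp add: matrix_matrix_mult_def sum_3 mat_def)
  with q1 q2 have "A $ 3 $ 3 \<noteq> 0" by auto
  with dichotomy have "coord N 3 x y 0 = 0" for x y by blast
  from this[of 1 0] this[of 0 1] show "N $ 3 $ 1 = 0" "N $ 3 $ 2 = 0" by (simp_all add: coord_def)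
qed

text \<open>If the third coordinate of \<open>N v\<close> did not involve \<open>z\<close>, then
  \<open>q\<close> would lie on the line \<open>Z = 0\<close>. First \<open>q\<close> is moved to a
  coordinate vertex, then the monomial \<open>X^(2m-2) Y^2\<close> of \<open>G\<close> gives a
  contradiction.\<close>

lemma center_off_axis: "N $ 3 $ 3 \<noteq> 0"
proof
  assume ga: "N $ 3 $ 3 = 0"
  have n: "(of_nat (2 * m) :: 'a) \<noteq> 0" "(of_nat m :: 'a) \<noteq> 0" "(2 :: 'a) \<noteq> 0"
    using nz[of "2 * m"] nz[of m] nz[of 2] m5 by simp_all
  have [simp]: "(0::'a) ^ m = 0" "(0::'a) ^ (m - Suc 0) = 0" "(0::'a) ^ (2 * m - Suc 0) = 0"
    using m5 by (simp_all add: power_0_left)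
  \<comment> \<open>The polar relation at the point with \<open>x = y = 0\<close> and
    \<open>z = 1\<close>.\<close>
  have q3: "A $ 3 $ 3 = 0"
    using polar[of 1 0 0] n m5 ga by (simp add: coord_def formG_axes formB_axes del: of_nat_mult)
  have one: "N $ 3 $ 1 * A $ 1 $ 3 + N $ 3 $ 2 * A $ 2 $ 3 = 1"
    using arg_cong[OF NA, of "\<lambda>M. M $ 3 $ 3"] q3 by (simp add: matrix_matrix_mult_def sum_3 mat_def)
  define k where "k = B (N $ 1 $ 3) (N $ 2 $ 3)"
  \<comment> \<open>The coefficient of \<open>z^m\<close> in \<open>polar_poly\<close>; on the right
    only \<open>formB\<close> can contribute it, and \<open>k\<close> is its top
    coefficient.\<close>
  have coeff_m: "formB_x m (a m) x y * A $ 1 $ 3 + formB_y m (a m) x y * A $ 2 $ 3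
      = (coord N 3 x y 0) ^ (m - 1) * (c * of_nat m * k)" for x y
  proof -
    have "coeff_at_top (formB m [:a m:] [:coord N 1 x y 0, N $ 1 $ 3:] [:coord N 2 x y 0, N $ 2 $ 3:]) m k"
      unfolding k_def using m5 by (intro coeff_at_top_formB coeff_at_top_linear) simp
    then show ?thesis
      using arg_cong[OF polar_poly[of x y], of "\<lambda>p. poly.coeff p m"] q3 ga m5
      by (simp add: poly_const_pow coeff_at_top_def coeff_pCons numeral_poly split: nat.splits)
  qed
  have "N $ 3 $ 2 = 0 \<or> A $ 1 $ 3 = 0"
  proof (rule disjCI)
    assume q1: "A $ 1 $ 3 \<noteq> 0"
    have "k \<noteq> 0"
      using coeff_m[of 1 0] q1 n m5 by (auto simp: formB_axes)
    then show "N $ 3 $ 2 = 0"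
      using coeff_m[of 0 1] n m5 c0 by (auto simp: formB_axes coord_def)
  qed
  moreover have False if be: "N $ 3 $ 2 = 0"
  proof -
    have q2: "A $ 2 $ 3 = 0"
      using polar[of 0 0 1] n m5 be q3 by (simp add: coord_def formG_axes formB_axes del: of_nat_mult)
    have q1: "A $ 1 $ 3 \<noteq> 0" using one be by auto
    \<comment> \<open>\<open>F\<close> restricted to the line through \<open>(0, 1, 0)\<close> and
      \<open>q\<close>. The right side has only the exponents \<open>2m\<close>, \<open>m\<close>,
      0, but on the left \<open>s^(2m-2)\<close> has the coefficient
      \<open>(A $ 1 $ 3)^(2m-2)\<close>.\<close>
    have eq: "formG m (\<lambda>i. [:a i:]) [:0, A $ 1 $ 3:] [:1:]
      = Polynomial.smult c (Polynomial.monom 1 (2 * m)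
         + Polynomial.monom (B (coord N 1 0 1 0) (coord N 2 0 1 0)) m + [:G (coord N 1 0 1 0) (coord N 2 0 1 0):])"
    proof (rule poly_eqI_alg_closed)
      fix s
      show "poly (formG m (\<lambda>i. [:a i:]) [:0, A $ 1 $ 3:] [:1:]) s
        = poly (Polynomial.smult c (Polynomial.monom 1 (2 * m)
         + Polynomial.monom (B (coord N 1 0 1 0) (coord N 2 0 1 0)) m
         + [:G (coord N 1 0 1 0) (coord N 2 0 1 0):])) s"
        using formF_line[of 0 s 1 0] q2 q3 be m5
        by (simp add: poly_forms poly_monom formF_def coord_def power_0_left)
    qed
    have "(A $ 1 $ 3) ^ (2 * m - 2) = 0"
      using arg_cong[OF eq, of "\<lambda>p. poly.coeff p (2 * m - 2)"] m5
      by (auto simp: coeff_formG_x coeff_pCons split: nat.splits)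
    with q1 show False by simp
  qed
  moreover have False if q1: "A $ 1 $ 3 = 0"
  proof -
    have q2: "A $ 2 $ 3 \<noteq> 0" using one q1 by auto
    \<comment> \<open>\<open>F\<close> restricted to the line through \<open>(1, 0, 0)\<close> and
      \<open>q\<close>. The left side is even in \<open>s\<close>, so the coefficient of
      \<open>s^(2m-1)\<close> forces \<open>N $ 3 $ 1 = 0\<close>; then the right side has no
      \<open>s^2\<close>, while the left side has.\<close>
    have eq: "formG m (\<lambda>i. [:a i:]) [:1:] [:0, A $ 2 $ 3:]
      = Polynomial.smult c ([:N $ 3 $ 1, 1:] ^ (2 * m)
         + Polynomial.smult (B (coord N 1 1 0 0) (coord N 2 1 0 0)) ([:N $ 3 $ 1, 1:] ^ m)
         + [:G (coord N 1 1 0 0) (coord N 2 1 0 0):])"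
    proof (rule poly_eqI_alg_closed)
      fix s
      show "poly (formG m (\<lambda>i. [:a i:]) [:1:] [:0, A $ 2 $ 3:]) s
        = poly (Polynomial.smult c ([:N $ 3 $ 1, 1:] ^ (2 * m)
         + Polynomial.smult (B (coord N 1 1 0 0) (coord N 2 1 0 0)) ([:N $ 3 $ 1, 1:] ^ m)
         + [:G (coord N 1 1 0 0) (coord N 2 1 0 0):])) s"
        using formF_line[of 1 s 0 0] q1 q3 m5
        by (simp add: poly_forms formF_def coord_def power_0_left)
    qed
    have "N $ 3 $ 1 = 0"
    proof -
      have "Polynomial.degree ([:N $ 3 $ 1, 1:] ^ m) \<le> m" by (simp add: degree_linear_power)
      then have "poly.coeff ([:N $ 3 $ 1, 1:] ^ m) (2 * m - 1) = 0"
        using m5 by (intro coeff_eq_0) simp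
      moreover have "2 * m choose (2 * m - 1) = 2 * m" using m5 binomial_symmetric[of 1 "2 * m"] by simp
      then have "poly.coeff ([:N $ 3 $ 1, 1:] ^ (2 * m)) (2 * m - 1) = of_nat (2 * m) * N $ 3 $ 1"
        using m5 by (subst coeff_linear_poly_power) (simp_all add: Suc_diff_Suc)
      ultimately show ?thesis
        using arg_cong[OF eq, of "\<lambda>p. poly.coeff p (2 * m - 1)"] m5 c0 n
          coeff_formG_y(1)[of m a 1 "A $ 2 $ 3"]
        by (simp add: coeff_pCons del: of_nat_mult split: nat.splits)
    qed
    then have "(A $ 2 $ 3) ^ 2 = 0"
      using arg_cong[OF eq, of "\<lambda>p. poly.coeff p 2"] m5
      by (simp add: coeff_formG_y linear0_power coeff_pCons split: nat.splits)
    with q2 show False by simp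
  qed
  ultimately show False by blast
qed

text \<open>Once \<open>Z\<close> is separated, the coefficients of powers of \<open>z\<close> show
  that the upper left block preserves \<open>B\<close> up to \<open>k^m\<close> and \<open>G\<close>
  up to \<open>k^(2m)\<close>. The factor \<open>X^(m-2)\<close> of \<open>B\<close> fixes the line
  \<open>X = 0\<close>; coefficients of \<open>G\<close> do the rest.\<close>

lemma diagonal:
  "A $ 1 $ 2 = 0" "A $ 1 $ 3 = 0" "A $ 2 $ 1 = 0" "A $ 2 $ 3 = 0" "A $ 3 $ 1 = 0" "A $ 3 $ 2 = 0"
  "(A $ 1 $ 1) ^ m = (A $ 3 $ 3) ^ m" "(A $ 2 $ 2) ^ 2 = (A $ 1 $ 1) ^ 2" "A $ 3 $ 3 \<noteq> 0"
proof -
  note N = center_off_axis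
  note cf = center_fixed[OF N]
  show "A $ 1 $ 3 = 0" "A $ 2 $ 3 = 0" by (rule cf)+
  have NAij: "(\<Sum>l\<in>UNIV. N $ 3 $ l * A $ l $ j) = (if j = 3 then 1 else 0)" for j
    using arg_cong[OF NA, of "\<lambda>M. M $ 3 $ j"] by (auto simp: matrix_matrix_mult_def mat_def)
  show A3: "A $ 3 $ 1 = 0" "A $ 3 $ 2 = 0" "A $ 3 $ 3 \<noteq> 0"
    using NAij[of 1] NAij[of 2] NAij[of 3] cf N by (auto simp: sum_3)
  define p q r s k where "p = A $ 1 $ 1" and "q = A $ 1 $ 2" and "r = A $ 2 $ 1" and "s = A $ 2 $ 2"
    and "k = A $ 3 $ 3"
  have k0: "k \<noteq> 0" using A3 by (simp add: k_def)
  have F: "F (p * x + q * y) (r * x + s * y) (k * z) = c * F x y z" for x y z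
    using sym[of x y z] cf A3 by (simp add: coord_def p_def q_def r_def s_def k_def)
  have c: "c = k ^ (2 * m)"
    using F[of 0 0 1] m5 by (simp add: formF_def formB_axes formG_axes power_0_left)
  have G: "G (p * x + q * y) (r * x + s * y) = c * G x y" for x y
    using F[of x y 0] m5 by (simp add: formF_def power_0_left)
  have B: "B (p * x + q * y) (r * x + s * y) = k ^ m * B x y" for x y
  proof -
    have "k ^ m * B (p * x + q * y) (r * x + s * y) = c * B x y"
      using F[of x y 1] G[of x y] c by (simp add: formF_def algebra_simps)
    also have "c = k ^ m * k ^ m" by (simp add: c mult_2 power_add)
    finally show ?thesis using k0 by simp
  qed
  have q: "q = 0"
  proof (rule ccontr)
    assume q: "q \<noteq> 0"
    \<comment> \<open>\<open>B = X^(m-2) (X^2 + a_m Y^2)\<close>, and \<open>Q\<close> is the second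
      factor after the substitution. As \<open>m - 2 \<ge> 3\<close>, \<open>x^3\<close> divides the
      transformed \<open>B\<close>; if \<open>q \<noteq> 0\<close>, it must divide \<open>Q\<close>,
      which has degree at most 2. So \<open>Q = 0\<close>, although the other side is
      nonzero.\<close>
    define Q where "Q = [:q, p:] ^ 2 + [:a m:] * [:s, r:] ^ 2"
    have split: "formB m [:a m:] u v = u ^ (m - 2) * (u ^ 2 + [:a m:] * v ^ 2)" for u v
    proof -
      have "m = m - 2 + 2" using m5 by simp
      then have "u ^ m = u ^ (m - 2) * u ^ 2" by (metis power_add)
      then show ?thesis by (simp add: formB_def distrib_left mult_ac del: mult_pCons_left mult_pCons_right)
    qed
    have "formB m [:a m:] [:q, p:] [:s, r:] = Polynomial.smult (k ^ m) (formB m [:a m:] [:0, 1:] [:1:])"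
    proof (rule poly_eqI_alg_closed)
      fix x
      show "poly (formB m [:a m:] [:q, p:] [:s, r:]) x
        = poly (Polynomial.smult (k ^ m) (formB m [:a m:] [:0, 1:] [:1:])) x"
        using B[of x 1] by (simp add: poly_forms add.commute mult.commute)
    qed
    then have eq: "[:q, p:] ^ (m - 2) * Q = [:0, 1:] ^ (m - 2) * Polynomial.smult (k ^ m) ([:0, 1:] ^ 2 + [:a m:] * [:1:] ^ 2)"
      unfolding split Q_def by (simp del: mult_pCons_left mult_pCons_right)
    have "[:- 0, 1:] ^ 3 dvd [:0, 1 :: 'a:] ^ (m - 2)" using m5 by (simp add: le_imp_power_dvd)
    then have "[:- 0, 1:] ^ 3 dvd [:q, p:] ^ (m - 2) * Q" unfolding eq by (rule dvd_mult2)
    then have "[:- 0, 1:] ^ 3 dvd Q"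
      by (rule linear_power_dvd_mult_cancel) (use q in simp)
    moreover have "Polynomial.degree Q \<le> 2"
      by (simp add: Q_def power2_eq_square)
    ultimately have "Q = 0"
      using dvd_imp_degree_le[of "[:- 0, 1:] ^ 3" Q] by (force simp: degree_linear_power)
    moreover have "[:0, 1:] ^ 2 + [:a m:] * [:1:] ^ 2 \<noteq> 0"
      by (simp add: power2_eq_square)
    ultimately show False
      using eq k0 by (simp del: mult_pCons_left mult_pCons_right)
  qed
  have s0: "s \<noteq> 0"
    using G[of 0 1] m5 c k0 q by (auto simp: formG_axes power_0_left)
  have r: "r = 0"
  proof -
    have "formG m (\<lambda>i. [:a i:]) [:0, p:] [:s, r:] = Polynomial.smult c (formG m (\<lambda>i. [:a i:]) [:0, 1:] [:1:])"
    proof (rule poly_eqI_alg_closed)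
      fix x
      show "poly (formG m (\<lambda>i. [:a i:]) [:0, p:] [:s, r:]) x
        = poly (Polynomial.smult c (formG m (\<lambda>i. [:a i:]) [:0, 1:] [:1:])) x"
        using G[of x 1] q by (simp add: poly_forms add.commute mult.commute)
    qed
    \<comment> \<open>The linear coefficient in \<open>x\<close>: on the right it vanishes because
      \<open>formG_x\<close> is 0 at \<open>x = 0\<close>.\<close>
    from arg_cong[OF this, of "\<lambda>P. poly (pderiv P) 0"]
    have "of_nat (2 * m) * s ^ (2 * m - 1) * r = 0"
      using m5 by (simp add: pderiv_formG pderiv_smult pderiv_pCons poly_forms formG_axes) blast
    then show ?thesis using s0 nz[of "2 * m"] m5 by (simp del: of_nat_mult)
  qed
  show "A $ 1 $ 2 = 0" "A $ 2 $ 1 = 0" using q r by (simp_all add: q_def r_def)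
  have p: "p ^ m = k ^ m" using B[of 1 0] r m5 by (simp add: formB_axes)
  then show "(A $ 1 $ 1) ^ m = (A $ 3 $ 3) ^ m" by (simp add: p_def k_def)
  have "p ^ m \<noteq> 0" using p k0 by simp
  then have p0: "p \<noteq> 0" using m5 by (auto simp: power_0_left)
  have "formG m (\<lambda>i. [:a i:]) [:p:] [:0, s:] = Polynomial.smult c (formG m (\<lambda>i. [:a i:]) [:1:] [:0, 1:])"
  proof (rule poly_eqI_alg_closed)
    fix x
    show "poly (formG m (\<lambda>i. [:a i:]) [:p:] [:0, s:]) x
      = poly (Polynomial.smult c (formG m (\<lambda>i. [:a i:]) [:1:] [:0, 1:])) x"
      using G[of 1 x] q r by (simp add: poly_forms mult.commute)
  qed
  from arg_cong[OF this, of "\<lambda>P. poly.coeff P 2"]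
  have "p ^ (2 * m - 2) * s ^ 2 = c" using m5 by (simp add: coeff_formG_y)
  also have "c = p ^ (2 * m - 2) * p ^ 2"
  proof -
    have "c = p ^ (2 * m)" by (simp add: c mult_2 power_add p)
    also have "2 * m = 2 * m - 2 + 2" using m5 by simp
    finally show ?thesis by (simp only: power_add)
  qed
  finally have "s ^ 2 = p ^ 2" using p0 by simp
  then show "(A $ 2 $ 2) ^ 2 = (A $ 1 $ 1) ^ 2" by (simp add: p_def s_def)
qed

end

subsection \<open>Automorphisms of the curve\<close>

text \<open>Homomorphisms as plain functions between types, so that \<open>to_ac\<close> can be
  lifted through three layers of \<open>map_poly\<close>.\<close>

definition ring_hom_fun :: "('a::comm_ring_1 \<Rightarrow> 'b::comm_ring_1) \<Rightarrow> bool" where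
  "ring_hom_fun f \<longleftrightarrow> f 0 = 0 \<and> f 1 = 1 \<and> (\<forall>x y. f (x + y) = f x + f y) \<and> (\<forall>x y. f (x * y) = f x * f y)"

lemma ring_hom_fun_sum: "ring_hom_fun f \<Longrightarrow> f (\<Sum>i\<in>I. g i) = (\<Sum>i\<in>I. f (g i))"
  by (induction I rule: infinite_finite_induct) (auto simp: ring_hom_fun_def)

lemma ring_hom_fun_power: "ring_hom_fun f \<Longrightarrow> f (x ^ n) = f x ^ n"
  by (induction n) (auto simp: ring_hom_fun_def)

lemma ring_hom_fun_map_poly:
  assumes f: "ring_hom_fun f"
  shows "ring_hom_fun (map_poly f)"
proof -
  have f0: "f 0 = 0" using f by (simp add: ring_hom_fun_def)
  have "map_poly f (p + q) = map_poly f p + map_poly f q" for p q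
    using f by (intro poly_eqI) (simp add: coeff_map_poly ring_hom_fun_def)
  moreover have "map_poly f (p * q) = map_poly f p * map_poly f q" for p q
  proof (rule poly_eqI)
    fix n
    have mult: "f (x * y) = f x * f y" for x y using f by (simp add: ring_hom_fun_def)
    show "poly.coeff (map_poly f (p * q)) n = poly.coeff (map_poly f p * map_poly f q) n"
      by (simp add: coeff_map_poly f0 coeff_mult ring_hom_fun_sum[OF f] mult)
  qed
  moreover have "map_poly f 1 = 1" using f by (simp add: ring_hom_fun_def)
  ultimately show ?thesis by (simp add: ring_hom_fun_def)
qed

lemma ring_hom_fun_poly3_ac: "ring_hom_fun poly3_ac"
  unfolding poly3_ac_def by (intro ring_hom_fun_map_poly) (simp add: ring_hom_fun_def)

lemma poly3_ac_simps:
  "poly3_ac (const3 c) = const3 (to_ac c)" "poly3_ac varX = varX" "poly3_ac varY = varY" "poly3_ac varZ = varZ"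
  "poly3_ac (P + Q) = poly3_ac P + poly3_ac Q" "poly3_ac (P * Q) = poly3_ac P * poly3_ac Q"
  "poly3_ac (P ^ n) = poly3_ac P ^ n" "poly3_ac (\<Sum>i\<in>I. g i) = (\<Sum>i\<in>I. poly3_ac (g i))"
proof -
  show "poly3_ac (const3 c) = const3 (to_ac c)" "poly3_ac varX = varX" "poly3_ac varY = varY" "poly3_ac varZ = varZ"
    by (simp_all add: poly3_ac_def const3_def varX_def varY_def varZ_def map_poly_pCons)
  show "poly3_ac (P + Q) = poly3_ac P + poly3_ac Q" "poly3_ac (P * Q) = poly3_ac P * poly3_ac Q"
    using ring_hom_fun_poly3_ac unfolding ring_hom_fun_def by blast+
  show "poly3_ac (P ^ n) = poly3_ac P ^ n" "poly3_ac (\<Sum>i\<in>I. g i) = (\<Sum>i\<in>I. poly3_ac (g i))"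
    by (rule ring_hom_fun_power[OF ring_hom_fun_poly3_ac] ring_hom_fun_sum[OF ring_hom_fun_poly3_ac])+
qed

lemma eval3_sum: "eval3 (\<Sum>i\<in>I. g i) v = (\<Sum>i\<in>I. eval3 (g i) v)"
  by (simp add: eval3_def poly_sum)

lemma eval3_family_curve:
  "eval3 (poly3_ac (family_curve m a)) v = formF m (\<lambda>i. to_ac (a i)) (v $ 1) (v $ 2) (v $ 3)"
  by (simp add: family_curve_def Let_def poly3_ac_simps eval3_simps eval3_sum formF_def formB_def formG_def
      algebra_simps)

lemma curve_points_family_curve:
  "curve_points (family_curve m a) = {v. v \<noteq> 0 \<and> formF m (\<lambda>i. to_ac (a i)) (v $ 1) (v $ 2) (v $ 3) = 0}"
  by (simp add: curve_points_def eval3_family_curve)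

lemma mat_ac_mult: "mat_ac (A ** C) = mat_ac A ** mat_ac C"
  by (simp add: mat_ac_def matrix_matrix_mult_def vec_eq_iff to_ac_sum)

lemma mat_ac_one: "mat_ac (mat 1) = mat 1"
  by (simp add: mat_ac_def mat_def vec_eq_iff)

lemma coord_matrix_vector_mult: "coord A i (v $ 1) (v $ 2) (v $ 3) = (A *v v) $ i"
  by (simp add: coord_def matrix_vector_mult_def sum_3)

lemma diag3_nth:
  "diag3 x y z $ 1 $ 1 = x" "diag3 x y z $ 2 $ 2 = y" "diag3 x y z $ 3 $ 3 = z"
  "diag3 x y z $ 1 $ 2 = 0" "diag3 x y z $ 1 $ 3 = 0" "diag3 x y z $ 2 $ 1 = 0"
  "diag3 x y z $ 2 $ 3 = 0" "diag3 x y z $ 3 $ 1 = 0" "diag3 x y z $ 3 $ 2 = 0"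
  by (simp_all add: diag3_def)

lemma diag3_mult: "diag3 x y z ** diag3 x' y' z' = diag3 (x * x') (y * y') (z * z')"
  by (simp add: vec_eq_iff forall_3 matrix_matrix_mult_def sum_3 diag3_nth)

lemma diag3_scalar: "diag3 x x x = mat x"
  by (simp add: vec_eq_iff forall_3 mat_def diag3_nth)

lemma mat_ac_diag3: "mat_ac (diag3 x y z) *v v = vector [to_ac x * v $ 1, to_ac y * v $ 2, to_ac z * v $ 3]"
  by (simp add: vec_eq_iff forall_3 mat_ac_def matrix_vector_mult_def sum_3 diag3_nth)

text \<open>The points live over the algebraic closure, so the locale results are applied to
  \<open>mat_ac A\<close>; injectivity of \<open>to_ac\<close> brings the relations between the
  entries back.\<close>

lemma automorphism_diagonal:
  fixes a :: "nat \<Rightarrow> 'K::field"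
  assumes m5: "m \<ge> 5" and nz: "\<And>n. 0 < n \<Longrightarrow> n \<le> 2 * m \<Longrightarrow> (of_nat n :: 'K) \<noteq> 0"
    and A: "invertible A"
    and img: "(\<lambda>v. mat_ac A *v v) ` curve_points (family_curve m a) = curve_points (family_curve m a)"
  obtains p s k where "A = diag3 p s k" "p ^ m = k ^ m" "s ^ 2 = p ^ 2" "k \<noteq> 0"
proof -
  define b where "b = (\<lambda>i. to_ac (a i))"
  interpret family m b
  proof
    fix n :: nat assume "0 < n" "n \<le> 2 * m"
    then show "(of_nat n :: 'K alg_closure) \<noteq> 0"
      using nz[of n] to_ac_eq_0_iff[of "of_nat n :: 'K"] by simp
  qed (rule m5)
  obtain N where N: "A ** N = mat 1" "N ** A = mat 1" using A by (auto simp: invertible_def)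
  have AN: "mat_ac A ** mat_ac N = mat 1" and NA: "mat_ac N ** mat_ac A = mat 1"
    using N by (simp_all add: mat_ac_one flip: mat_ac_mult)
  let ?A = "mat_ac A" and ?N = "mat_ac N"
  have zeros: "F (coord ?A 1 x y z) (coord ?A 2 x y z) (coord ?A 3 x y z) = 0" if "F x y z = 0" for x y z
  proof -
    define v :: "'K alg_closure ^ 3" where "v = vector [x, y, z]"
    have v: "v $ 1 = x" "v $ 2 = y" "v $ 3 = z" by (simp_all add: v_def)
    show ?thesis
    \<comment> \<open>The zero vector is no curve point, but \<open>F\<close> vanishes at its image
      as well.\<close>
    proof (cases "v = 0")
      case True
      then show ?thesis using that v by (simp add: coord_def)
    next
      case False
      then have "v \<in> curve_points (family_curve m a)"
        using that v by (simp add: curve_points_family_curve b_def)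
      then have "?A *v v \<in> curve_points (family_curve m a)" using img by blast
      then show ?thesis
        using v by (simp add: curve_points_family_curve b_def flip: coord_matrix_vector_mult)
    qed
  qed
  define c where "c = F (?A $ 1 $ 3) (?A $ 2 $ 3) (?A $ 3 $ 3)"
  have sym: "F (coord ?A 1 x y z) (coord ?A 2 x y z) (coord ?A 3 x y z) = c * F x y z" for x y z
    unfolding c_def by (rule formF_linear_change[OF zeros])
  have "F 0 0 1 = 1" using m5 by (simp add: formF_def formG_axes formB_axes power_0_left)
  \<comment> \<open>\<open>c = 0\<close> would make \<open>F\<close> vanish on the whole image of
    \<open>mat_ac A\<close>, which contains \<open>(0, 0, 1)\<close>.\<close>
  then have "c \<noteq> 0"
    using sym[of "coord ?N 1 0 0 1" "coord ?N 2 0 0 1" "coord ?N 3 0 0 1"] coord_inverse[OF AN] by auto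
  then interpret family_symmetry m b ?A ?N c
    using AN NA sym by unfold_locales auto
  have ent: "?A $ i $ j = to_ac (A $ i $ j)" for i j by (simp add: mat_ac_def)
  have "A = diag3 (A $ 1 $ 1) (A $ 2 $ 2) (A $ 3 $ 3)"
    using diagonal(1-6) by (simp add: vec_eq_iff forall_3 diag3_nth ent)
  moreover have "to_ac (A $ 1 $ 1 ^ m) = to_ac (A $ 3 $ 3 ^ m)" "to_ac (A $ 2 $ 2 ^ 2) = to_ac (A $ 1 $ 1 ^ 2)"
    using diagonal(7,8) by (simp_all add: ent)
  then have "A $ 1 $ 1 ^ m = A $ 3 $ 3 ^ m" "A $ 2 $ 2 ^ 2 = A $ 1 $ 1 ^ 2"
    unfolding to_ac_eq_iff by blast+
  moreover have "A $ 3 $ 3 \<noteq> 0" using diagonal(9) by (simp add: ent)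
  ultimately show ?thesis using that by blast
qed

section \<open>Roots of unity\<close>

lemma primitive_root_of_unity_dvd:
  assumes "primitive_root_of_unity m \<zeta>" and "\<zeta> ^ n = 1"
  shows "m dvd n"
proof -
  have "\<zeta> ^ n = \<zeta> ^ (m * (n div m) + n mod m)" by simp
  also have "\<dots> = (\<zeta> ^ m) ^ (n div m) * \<zeta> ^ (n mod m)" by (simp only: power_add power_mult)
  finally have "\<zeta> ^ (n mod m) = 1" using assms by (simp add: primitive_root_of_unity_def)
  moreover have "n mod m < m" using assms by (simp add: primitive_root_of_unity_def)
  ultimately have "n mod m = 0" using assms(1) by (auto simp: primitive_root_of_unity_def)
  then show ?thesis by auto
qed

text \<open>The \<open>m\<close> powers of \<open>\<zeta>\<close> are distinct roots of
  \<open>X^m - 1\<close>, which has at most \<open>m\<close> roots, so they exhaust them.\<close>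

lemma root_of_unity_eq_power:
  assumes \<zeta>: "primitive_root_of_unity m \<zeta>" and x: "x ^ m = 1"
  obtains j where "x = \<zeta> ^ j"
proof -
  have m: "m > 0" and \<zeta>m: "\<zeta> ^ m = 1" using \<zeta> by (auto simp: primitive_root_of_unity_def)
  define P where "P = Polynomial.monom 1 m - [:1 :: 'a:]"
  have P: "poly P y = y ^ m - 1" for y by (simp add: P_def poly_monom)
  have deg: "Polynomial.degree P \<le> m"
    unfolding P_def by (intro degree_diff_le) (simp_all add: degree_monom_le)
  have "poly.coeff P m = 1" using m by (simp add: P_def coeff_pCons split: nat.splits)
  then have "P \<noteq> 0" by auto
  have fin: "finite {y. poly P y = 0}" and card: "card {y. poly P y = 0} \<le> m"
    using poly_roots_finite[OF \<open>P \<noteq> 0\<close>] card_poly_roots_bound[OF \<open>P \<noteq> 0\<close>] deg by simp_all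
  have "\<zeta> \<noteq> 0" using \<zeta>m m by (auto simp: power_0_left)
  have inj: "inj_on (\<lambda>j. \<zeta> ^ j) {..<m}"
  proof (rule linorder_inj_onI')
    fix i j assume "i \<in> {..<m}" "j \<in> {..<m}" "i < j"
    have "\<zeta> ^ i \<noteq> \<zeta> ^ j"
    proof
      assume "\<zeta> ^ i = \<zeta> ^ j"
      moreover have "\<zeta> ^ j = \<zeta> ^ i * \<zeta> ^ (j - i)" using \<open>i < j\<close> by (simp flip: power_add)
      ultimately have "\<zeta> ^ i * \<zeta> ^ (j - i) = \<zeta> ^ i * 1" by simp
      then have "m dvd j - i"
        using \<open>\<zeta> \<noteq> 0\<close> primitive_root_of_unity_dvd[OF \<zeta>] by simp
      then show False using \<open>i < j\<close> \<open>j \<in> {..<m}\<close> by (auto dest: dvd_imp_le)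
    qed
    then show "\<zeta> ^ i \<noteq> \<zeta> ^ j" .
  qed
  have "(\<lambda>j. \<zeta> ^ j) ` {..<m} \<subseteq> {y. poly P y = 0}"
    using \<zeta>m by (auto simp: P) (metis mult.commute power_mult power_one)
  then have "(\<lambda>j. \<zeta> ^ j) ` {..<m} = {y. poly P y = 0}"
    using card card_image[OF inj] by (intro card_seteq fin) simp_all
  moreover have "x \<in> {y. poly P y = 0}" using x by (simp add: P)
  ultimately show ?thesis using that by blast
qed

section \<open>Classes of matrices in the projective linear group\<close>

lemma proj_class_eq: "proj_class A = {mat c ** A | c. c \<noteq> 0}"
  by (auto simp: proj_class_def r_coset_def scalars3_def GL3_def)

lemma proj_class_scale:
  fixes A :: "'a::field ^ 3 ^ 3"
  assumes "p \<noteq> 0"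
  shows "proj_class (mat p ** A) = proj_class A"
proof -
  have mm: "mat c ** (mat d ** A) = mat (c * d) ** A" for c d :: 'a
    by (simp add: scalar_mat_mult mult.assoc)
  show ?thesis
  proof (intro equalityI subsetI)
    fix M assume "M \<in> proj_class (mat p ** A)"
    then obtain c where "c \<noteq> 0" "M = mat (c * p) ** A" by (auto simp: proj_class_eq mm)
    moreover from this(1) assms have "c * p \<noteq> 0" by simp
    ultimately show "M \<in> proj_class A" unfolding proj_class_eq by blast
  next
    fix M assume "M \<in> proj_class A"
    then obtain c where "c \<noteq> 0" "M = mat c ** A" by (auto simp: proj_class_eq)
    then have "c / p \<noteq> 0" "M = mat (c / p) ** (mat p ** A)" using assms by (simp_all add: mm)
    then show "M \<in> proj_class (mat p ** A)" unfolding proj_class_eq by blast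
  qed
qed

lemma proj_class_in_carrier: "invertible A \<Longrightarrow> proj_class A \<in> carrier PGL3"
  by (auto simp: PGL3_def FactGroup_def RCOSETS_def proj_class_def GL3_def)

lemma proj_class_mult:
  assumes "invertible A" "invertible C"
  shows "proj_class A \<otimes>\<^bsub>PGL3\<^esub> proj_class C = proj_class (A ** C)"
  using normal.rcos_sum[OF normal_scalars3, of A C] assms
  by (simp add: PGL3_def FactGroup_def proj_class_def GL3_def)

lemma proj_class_one: "proj_class (mat 1) = \<one>\<^bsub>PGL3\<^esub>"
  by (auto simp: proj_class_eq PGL3_def FactGroup_def scalars3_def)

section \<open>The cyclic group of diagonal symmetries and the order of its generator\<close>

lemma formF_diagonal_invariant:
  assumes "e ^ 2 = 1" "w ^ m = 1"
  shows "formF m a x (e * y) (w * z) = formF m a x y z"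
proof -
  \<comment> \<open>\<open>y\<close> occurs in \<open>F\<close> only to even powers and
    \<open>z\<close> only to the powers \<open>m\<close> and \<open>2m\<close>.\<close>
  have "e ^ (2 * i) = 1" for i by (simp add: power_mult assms)
  moreover have "w ^ (2 * m) = 1" by (simp add: power_mult assms mult.commute[of 2 m])
  ultimately show ?thesis
    using assms by (simp add: formF_def formB_def formG_def power_mult_distrib)
qed

text \<open>The \<open>n\<close>-th power of the matrix of \<open>[X : -Y : \<zeta> Z]\<close>. With
  natural exponents an inverse is again a twist, of exponent \<open>(2m-1) n\<close>.\<close>

definition twist :: "'a::field \<Rightarrow> nat \<Rightarrow> 'a ^ 3 ^ 3" where
  "twist \<zeta> n = diag3 1 ((- 1) ^ n) (\<zeta> ^ n)"

lemma twist_mult: "twist \<zeta> i ** twist \<zeta> j = twist \<zeta> (i + j)"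
  by (simp add: twist_def diag3_mult power_add)

lemma twist_period:
  assumes "\<zeta> ^ m = 1"
  shows "twist \<zeta> (2 * m * n) = mat 1"
proof -
  have "\<zeta> ^ (2 * m * n) = (\<zeta> ^ m) ^ (2 * n)" by (simp add: mult_ac flip: power_mult)
  then show ?thesis using assms by (simp add: twist_def diag3_scalar)
qed

lemma twist_inverse:
  assumes "\<zeta> ^ m = 1" "m > 0"
  shows "twist \<zeta> n ** twist \<zeta> ((2 * m - 1) * n) = mat 1" "twist \<zeta> ((2 * m - 1) * n) ** twist \<zeta> n = mat 1"
proof -
  have "n + (2 * m - 1) * n = 2 * m * n" using assms(2) by (simp add: algebra_simps)
  then show "twist \<zeta> n ** twist \<zeta> ((2 * m - 1) * n) = mat 1" "twist \<zeta> ((2 * m - 1) * n) ** twist \<zeta> n = mat 1"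
    by (simp_all only: twist_mult twist_period[OF assms(1)] add.commute)
qed

lemma twist_invertible: "\<zeta> ^ m = 1 \<Longrightarrow> m > 0 \<Longrightarrow> invertible (twist \<zeta> n)"
  unfolding invertible_def using twist_inverse by blast

text \<open>Each twist maps the point set into itself; it is onto because its inverse is a twist
  too.\<close>

lemma twist_automorphism:
  assumes "\<zeta> ^ m = 1" "m > 0"
  shows "(\<lambda>v. mat_ac (twist \<zeta> n) *v v) ` curve_points (family_curve m a) = curve_points (family_curve m a)"
    (is "?f n ` ?S = ?S")
proof -
  have inv: "mat_ac (twist \<zeta> n) *v (mat_ac (twist \<zeta> ((2 * m - 1) * n)) *v v) = v"
      "mat_ac (twist \<zeta> ((2 * m - 1) * n)) *v (mat_ac (twist \<zeta> n) *v v) = v" for n v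
    using twist_inverse[OF assms]
    by (simp_all add: matrix_vector_mul_assoc mat_ac_one flip: mat_ac_mult)
  have sub: "mat_ac (twist \<zeta> n) *v v \<in> ?S" if "v \<in> ?S" for n v
  proof -
    have "mat_ac (twist \<zeta> n) *v v \<noteq> 0"
      using that inv(2)[of n v] by (auto simp: curve_points_family_curve)
    moreover have "to_ac ((- 1) ^ n) ^ 2 = (1 :: 'a alg_closure)" by (simp flip: power_mult power_mult_distrib)
    moreover have "to_ac (\<zeta> ^ n) ^ m = (1 :: 'a alg_closure)"
      using assms(1) by (metis mult.commute power_mult power_one to_ac_1 to_ac_power)
    ultimately show ?thesis
      using that formF_diagonal_invariant[of "to_ac ((- 1) ^ n)" "to_ac (\<zeta> ^ n)" m]
      by (simp add: curve_points_family_curve twist_def mat_ac_diag3 del: to_ac_power)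
  qed
  have "v \<in> ?f n ` ?S" if "v \<in> ?S" for v
    using sub[OF that, of "(2 * m - 1) * n"] inv(1)[of n v] by (metis imageI)
  then show ?thesis using sub by blast
qed

lemma proj_class_twist_pow:
  assumes "\<zeta> ^ m = 1" "m > 0"
  shows "proj_class (twist \<zeta> 1) [^]\<^bsub>PGL3\<^esub> n = proj_class (twist \<zeta> n)"
proof (induction n)
  case 0
  show ?case by (simp add: proj_class_one[symmetric] twist_def diag3_scalar)
next
  case (Suc n)
  then show ?case
    using proj_class_mult[of "twist \<zeta> n" "twist \<zeta> 1"] twist_invertible[OF assms] by (simp add: twist_mult)
qed

text \<open>A twist that is a scalar matrix is the identity, since its first entry is 1. Its
  exponent is then even and divisible by \<open>m\<close>, hence by \<open>2m\<close> as
  \<open>m\<close> is odd.\<close>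

lemma ord_proj_class_twist:
  fixes \<zeta> :: "'a::field"
  assumes \<zeta>: "primitive_root_of_unity m \<zeta>" and "odd m" and two: "(2 :: 'a) \<noteq> 0"
  shows "group.ord PGL3 (proj_class (twist \<zeta> 1)) = 2 * m"
proof -
  interpret group "PGL3 :: ('a ^ 3 ^ 3) set monoid" by (rule group_PGL3)
  have m: "\<zeta> ^ m = 1" "m > 0" using \<zeta> by (auto simp: primitive_root_of_unity_def)
  let ?g = "proj_class (twist \<zeta> 1)"
  have g: "?g \<in> carrier PGL3" by (rule proj_class_in_carrier[OF twist_invertible[OF m]])
  have "?g [^]\<^bsub>PGL3\<^esub> (2 * m) = \<one>\<^bsub>PGL3\<^esub>"
    unfolding proj_class_twist_pow[OF m] using twist_period[OF m(1), of 1] by (simp add: proj_class_one)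
  then have "ord ?g dvd 2 * m" using pow_eq_id[OF g] by blast
  moreover have "2 * m dvd ord ?g"
  proof -
    define n where "n = ord ?g"
    have "proj_class (twist \<zeta> n) = proj_class (mat 1)"
      using pow_ord_eq_1[OF g] unfolding proj_class_twist_pow[OF m] by (simp add: proj_class_one n_def)
    moreover have "twist \<zeta> n \<in> proj_class (twist \<zeta> n)"
      by (auto simp: proj_class_eq intro: exI[of _ 1])
    ultimately obtain c where "twist \<zeta> n = mat c ** mat 1" by (auto simp: proj_class_eq)
    then have c: "twist \<zeta> n = diag3 c c c" by (simp add: diag3_scalar)
    from arg_cong[OF c, of "\<lambda>M. M $ 1 $ 1"] arg_cong[OF c, of "\<lambda>M. M $ 2 $ 2"] arg_cong[OF c, of "\<lambda>M. M $ 3 $ 3"]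
    have e: "(- 1 :: 'a) ^ n = 1" "\<zeta> ^ n = 1" by (simp_all add: twist_def diag3_nth)
    have "m dvd n" using primitive_root_of_unity_dvd[OF \<zeta> e(2)] .
    moreover have "even n"
    proof (rule ccontr)
      assume "odd n"
      then have "(- 1 :: 'a) = 1" using e(1) by simp
      then have "(2 :: 'a) = 0" by (simp add: numeral_2_eq_2 neg_eq_iff_add_eq_0)
      with two show False by simp
    qed
    ultimately show ?thesis using \<open>odd m\<close> by (simp add: n_def divides_mult coprime_commute)
  qed
  ultimately show ?thesis by (rule dvd_antisym)
qed

section \<open>The automorphism group and its order\<close>

theorem theorem4p7:
  fixes \<iota> :: "'k::field \<Rightarrow> 'K::field" and m d g :: nat and a :: "nat \<Rightarrow> 'K" and \<zeta> :: 'K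
  assumes "odd m" and "d = 2 * m" and "d \<ge> 10" and "g = (d - 1) * (d - 2) div 2"
    and "CHAR('k) = 0 \<or> CHAR('k) > 2 * g + 1"
    and "is_separable_closure \<iota>"
    and "primitive_root_of_unity m \<zeta>"
    and "smooth_curve (family_curve m a)"
  shows "curve_Aut (family_curve m a) = generate PGL3 {proj_class (diag3 1 (- 1) \<zeta>)}
    \<and> cyclic_group (PGL3\<lparr>carrier := curve_Aut (family_curve m a)\<rparr>)
    \<and> order (PGL3\<lparr>carrier := curve_Aut (family_curve m a)\<rparr>) = d"
proof -
  interpret group "PGL3 :: ('K ^ 3 ^ 3) set monoid" by (rule group_PGL3)
  have m5: "m \<ge> 5" using assms(2,3) by simp
  have m: "\<zeta> ^ m = 1" "m > 0" using assms(7) by (auto simp: primitive_root_of_unity_def)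
  have nz: "(of_nat n :: 'K) \<noteq> 0" if "0 < n" "n \<le> 2 * m" for n
  proof -
    have \<iota>: "\<iota> 1 = 1" "\<And>x y. \<iota> (x + y) = \<iota> x + \<iota> y" "\<And>x y. \<iota> (x * y) = \<iota> x * \<iota> y"
      using assms(6) by (auto simp: is_separable_closure_def)
    have \<iota>0: "\<iota> 0 = 0" using \<iota>(2)[of 0 0] by (metis add.right_neutral add_left_imp_eq)
    have \<iota>n: "\<iota> (of_nat n) = of_nat n" for n by (induction n) (simp_all add: \<iota> \<iota>0)
    \<comment> \<open>From \<open>d - 1 \<le> g\<close>; so a positive characteristic exceeds every
      \<open>n \<le> 2m\<close> and cannot divide it.\<close>
    have "2 * m \<le> 2 * g + 1"
    proof -
      have "(d - 1) * (d - 2) \<ge> (d - 1) * 2" using assms(3) by (intro mult_left_mono) auto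
      then have "(d - 1) * 2 div 2 \<le> g" unfolding assms(4) by (rule div_le_mono)
      then have "d - 1 \<le> g" by simp
      then show ?thesis using assms(2,3) by simp
    qed
    with that assms(5) have "\<not> CHAR('k) dvd n" by (auto dest: dvd_imp_le)
    then have "(of_nat n :: 'k) \<noteq> 0" by (simp add: of_nat_eq_0_iff_char_dvd)
    then have "\<iota> (of_nat n) * \<iota> (inverse (of_nat n)) = 1" by (simp add: \<iota>(1) flip: \<iota>(3))
    then show ?thesis unfolding \<iota>n by auto
  qed
  have two: "(2 :: 'K) \<noteq> 0" using nz[of 2] m5 by simp
  let ?g = "proj_class (twist \<zeta> 1)"
  have g: "?g \<in> carrier PGL3" by (rule proj_class_in_carrier[OF twist_invertible[OF m]])
  have ord: "ord ?g = 2 * m" using ord_proj_class_twist[OF assms(7,1) two] .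
  have Aut: "curve_Aut (family_curve m a) = range (\<lambda>n. proj_class (twist \<zeta> n))"
  proof (intro equalityI subsetI)
    fix C assume "C \<in> curve_Aut (family_curve m a)"
    then obtain A where A: "C = proj_class A" "invertible A"
        "(\<lambda>v. mat_ac A *v v) ` curve_points (family_curve m a) = curve_points (family_curve m a)"
      unfolding curve_Aut_def by blast
    obtain p s k where psk: "A = diag3 p s k" "p ^ m = k ^ m" "s ^ 2 = p ^ 2" "k \<noteq> 0"
      using automorphism_diagonal[OF m5 nz A(2,3)] by blast
    have p0: "p \<noteq> 0" using psk(2,4) m(2) by (metis power_eq_0_iff)
    have "(k / p) ^ m = 1" using psk(2,4) p0 by (simp add: power_divide)
    then obtain j where j: "k / p = \<zeta> ^ j" using root_of_unity_eq_power[OF assms(7)] by blast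
    have "s = p \<or> s = - p" using psk(3) by (simp add: power2_eq_iff)
    then obtain e :: nat where e: "s = (- 1) ^ e * p"
      by (metis mult_1 mult_minus1 power_0 power_one_right)
    \<comment> \<open>Only the class of \<open>j\<close> modulo \<open>m\<close> matters for
      \<open>\<zeta> ^ j\<close>. Adding the odd number \<open>m\<close> switches the parity, so
      both conditions can be met.\<close>
    obtain n where n: "\<zeta> ^ n = \<zeta> ^ j" "even n \<longleftrightarrow> even e"
    proof (cases "even j \<longleftrightarrow> even e")
      case True
      then show ?thesis using that by blast
    next
      case False
      then show ?thesis using that[of "j + m"] m(1) assms(1) by (simp add: power_add)
    qed
    have "(- 1 :: 'K) ^ n = (- 1) ^ e" using n(2) by (cases "even n") simp_all
    then have "A = mat p ** twist \<zeta> n"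
      using j n(1) e p0 by (simp add: psk(1) twist_def diag3_mult field_simps flip: diag3_scalar)
    then show "C \<in> range (\<lambda>n. proj_class (twist \<zeta> n))"
      using A(1) proj_class_scale[OF p0] by blast
  next
    fix C assume "C \<in> range (\<lambda>n. proj_class (twist \<zeta> n))"
    then show "C \<in> curve_Aut (family_curve m a)"
      unfolding curve_Aut_def using twist_invertible[OF m] twist_automorphism[OF m] by blast
  qed
  also have "\<dots> = {?g [^]\<^bsub>PGL3\<^esub> n | n. n \<in> (UNIV :: nat set)}"
    unfolding proj_class_twist_pow[OF m] by blast
  \<comment> \<open>The generator has finite order, so its nonnegative powers already form the
    generated subgroup.\<close>
  also have "\<dots> = generate PGL3 {?g}"
    using generate_pow_nat[OF g] ord m(2) by simp
  finally have gen: "curve_Aut (family_curve m a) = generate PGL3 {?g}" .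
  have "cyclic_group (PGL3\<lparr>carrier := generate PGL3 {?g}\<rparr>)"
    using cyclic_group_generated[of ?g] g by (simp add: subgroup_generated_def)
  moreover have "order (PGL3\<lparr>carrier := generate PGL3 {?g}\<rparr>) = d"
    using generate_pow_card[OF g] ord assms(2) by (simp add: order_def)
  moreover have "twist \<zeta> 1 = diag3 1 (- 1) \<zeta>" by (simp add: twist_def)
  ultimately show ?thesis using gen by simp
qed

end
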